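(* Let $\mathcal I$ be a finite set (which may depend on $N$) and $\mathcal I_i\subset\mathcal I$, $1\le i\le N$. Let $\{x_\alpha,\alpha\in\mathcal I\}$ be a collection of independent random variables and let $\mathcal Z_1,\ldots,\mathcal Z_N$ be random variables which are functions of $\{x_\alpha,\alpha\in\mathcal I\}$. Let $\Xi$ be an event and $p$ an even integer, which may depend on $N$. Suppose that the following assumptions hold with some constants $C_0,c_0>0$: (i) (Bound on $Q_A\mathcal Z_i$ in $\Xi$.) There exist deterministic positive numbers $\mathcal X<1$ and $\mathcal Y$ such that for any set $A\subset\{1,2,\ldots,N\}$ with $i\in A$ and $|A|\le p$, $Q_A\mathcal Z_i$ in $\Xi$ can be written as the sum of two new random variables, $$\mathbf 1(\Xi)(Q_A\mathcal Z_i)=\mathcal Z_{i,A}+\mathbf 1(\Xi)\,Q_A\mathbf 1(\Xi^c)\,\widetilde{\mathcal Z}_{i,A},$$ with $$|\mathcal Z_{i,A}|\le\mathcal Y\,(C_0\mathcal X|A|)^{|A|},\qquad|\widetilde{\mathcal Z}_{i,A}|\le\mathcal YN^{C_0|A|}.$$ (ii) (Rough bound on $\mathcal Z_i$.) $\max_i|\mathcal Z_i|\le\mathcal YN^{C_0}$. (iii) ($\Xi$ is a high probability event.) $\mathbb P[\Xi^c]\le e^{-c_0(\log N)^{3/2}p}$. Then $$\mathbb E[\mathcal Q\mathcal Z]^p\le(Cp)^{4p}\bigl[\mathcal X^2+N^{-1}\bigr]^p\mathcal Y^p$$ for some $C>0$ and any sufficiently large $N$.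
   Context: $\mathbb E_i$ denotes the expectation with respect to the variables $\{x_\alpha,\alpha\in\mathcal I_i\}$ (all other $x_\alpha$ being held fixed). $P_i=\mathbb E_i$ and $Q_i=1-\mathbb E_i$; these are commuting projections. For $A\subset\{1,\ldots,N\}$, $Q_A=\prod_{i\in A}Q_i$. $[\mathcal Q\mathcal Z]=\frac1N\sum_{i=1}^NQ_i\mathcal Z_i$, and $\mathbb E[\mathcal Q\mathcal Z]^p$ means the expectation of the $p$-th power of $[\mathcal Q\mathcal Z]$. $\mathbf 1(\cdot)$ denotes the indicator function; $Q_A\mathbf 1(\Xi^c)\widetilde{\mathcal Z}_{i,A}$ means $Q_A$ applied to the product $\mathbf 1(\Xi^c)\widetilde{\mathcal Z}_{i,A}$. *)

theory Defs
  imports "HOL-Probability.Probability"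
begin

text \<open>
  Every random variable that is a function of the family \<open>(x \<alpha>)\<close>, \<open>\<alpha> \<in> I\<close>, is represented by a
  function \<open>f\<close> on the configuration space \<open>space (PiM I S)\<close>; the random variable itself is
  \<open>\<lambda>\<omega>. f (config I x \<omega>)\<close>.
\<close>

definition config :: "'i set \<Rightarrow> ('i \<Rightarrow> 'a \<Rightarrow> 'b) \<Rightarrow> 'a \<Rightarrow> ('i \<Rightarrow> 'b)"
  where "config I x \<omega> = (\<lambda>\<alpha>\<in>I. x \<alpha> \<omega>)"

text \<open>
  Expectation with respect to the variables \<open>x \<alpha>\<close>, \<open>\<alpha> \<in> J\<close>, the coordinates of \<open>y\<close> outside \<open>J\<close>
  being held fixed.  By independence, this is a version of the conditional expectation given
  \<open>(x \<alpha>)\<close>, \<open>\<alpha> \<in> I - J\<close>.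
\<close>

definition partial_expectation ::
    "'a measure \<Rightarrow> 'i set \<Rightarrow> ('i \<Rightarrow> 'a \<Rightarrow> 'b) \<Rightarrow> 'i set \<Rightarrow> (('i \<Rightarrow> 'b) \<Rightarrow> real) \<Rightarrow> ('i \<Rightarrow> 'b) \<Rightarrow> real"
  where "partial_expectation M I x J f y =
    (LINT \<omega>|M. f (\<lambda>\<alpha>\<in>I. if \<alpha> \<in> J then x \<alpha> \<omega> else y \<alpha>))"

definition Q_op ::
    "'a measure \<Rightarrow> 'i set \<Rightarrow> ('i \<Rightarrow> 'a \<Rightarrow> 'b) \<Rightarrow> 'i set \<Rightarrow> (('i \<Rightarrow> 'b) \<Rightarrow> real) \<Rightarrow> ('i \<Rightarrow> 'b) \<Rightarrow> real"
  where "Q_op M I x J f y = f y - partial_expectation M I x J f y"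

text \<open>
  The operators \<open>Q_op M I x (J i)\<close> commute only up to null sets on functions that are merely
  almost surely bounded, so the product over \<open>A\<close> is composed in a fixed (increasing) order
  instead of being folded over the set.
\<close>

definition Q_prod ::
    "'a measure \<Rightarrow> 'i set \<Rightarrow> ('i \<Rightarrow> 'a \<Rightarrow> 'b) \<Rightarrow> (nat \<Rightarrow> 'i set) \<Rightarrow> nat set \<Rightarrow>
      (('i \<Rightarrow> 'b) \<Rightarrow> real) \<Rightarrow> ('i \<Rightarrow> 'b) \<Rightarrow> real"
  where "Q_prod M I x J A f = foldr (\<lambda>i. Q_op M I x (J i)) (sorted_list_of_set A) f"

definition Q_average ::
    "'a measure \<Rightarrow> 'i set \<Rightarrow> ('i \<Rightarrow> 'a \<Rightarrow> 'b) \<Rightarrow> (nat \<Rightarrow> 'i set) \<Rightarrow> nat \<Rightarrow>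
      (nat \<Rightarrow> ('i \<Rightarrow> 'b) \<Rightarrow> real) \<Rightarrow> ('i \<Rightarrow> 'b) \<Rightarrow> real"
  where "Q_average M I x J N Z y = (1 / real N) * (\<Sum>i=1..N. Q_op M I x (J i) (Z i) y)"

end

theory Submission
  imports Defs
begin

text \<open>
  Expanding the \<open>p\<close>-th power of the average gives \<open>1 / N\<^sup>p\<close> times the sum, over all tuples
  \<open>i\<^sub>1, \<dots>, i\<^sub>p\<close>, of the expectations of \<open>\<Prod>k. Q\<^bsub>i\<^sub>k\<^esub> Z\<^bsub>i\<^sub>k\<^esub>\<close>.  A tuple with \<open>s\<close> distinct values belongs to
  a family of about \<open>N\<^sup>s\<close> tuples, so its expectation has to gain a factor \<open>X\<^sup>2\<^sup>s\<close> for the total to be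
  comparable with \<open>(X\<^sup>2 + 1/N)\<^sup>p\<close>.  By assumption, every operator \<open>Q\<close> acting on some \<open>Z\<close> is worth a
  factor \<open>X\<close>.

  The tuple starts with one \<open>Q\<close> per factor.  A value \<open>j\<close> that occurs only once provides only one \<open>Q\<^sub>j\<close>, but
  there the expectation has a cancellation: if all the other factors were averaged over the
  variables of \<open>j\<close>, the expectation would vanish, since \<open>P\<^sub>j Q\<^sub>j = 0\<close>.  Telescoping between the other
  factors \<open>F\<close> and their averages \<open>P\<^sub>j F\<close> replaces the expectation by a sum of at most \<open>p\<close> expectations,
  each of which contains exactly one more operator, namely a second \<open>Q\<^sub>j\<close>
  (lemma \<open>abs_integral_prod_expand_one\<close>).  Treating the values that occur once
  one after the other (lemma \<open>abs_integral_prod_expand\<close>) costs at most \<open>p\<^sup>p\<close> terms, and every final term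
  has \<open>n\<close> operators \<open>Q\<close> with \<open>2s \<le> n \<le> 2p\<close>.  Expanding only as far as necessary is essential: the full
  expansion of every factor over every value would produce up to \<open>p\<^sup>2\<close> operators, and the factors
  \<open>(C\<^sub>0 p)\<^sup>n\<close> and \<open>N\<close> to the power \<open>C\<^sub>0 n\<close> that come with them would not be affordable.

  In a final term every factor is a main part of size \<open>Y (C\<^sub>0 X |A|)\<close> to the power \<open>|A|\<close> plus an error
  caused by the complement of \<open>\<Xi>\<close>.
  The product of the main parts is at most \<open>Y\<^sup>p (C\<^sub>0 p)\<^sup>2\<^sup>p X\<^sup>2\<^sup>s\<close>.  If an error occurs, it is estimated once in
  \<open>L\<^sup>1\<close>, where it contains the probability of the complement of \<open>\<Xi>\<close>, and all other factors are
  estimated by their suprema; since \<open>n \<le> 2p\<close>, this loses no more than the powers \<open>2p\<close> of \<open>4 C\<^sub>0 p\<close>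
  and \<open>2 C\<^sub>0 p\<close> of \<open>N\<close>, if \<open>C\<^sub>0 \<ge> 1\<close>, as may be assumed.  The first fits into the claimed bound, and the
  second is beaten by \<open>exp (- c\<^sub>0 (log N)\<^sup>3\<^sup>/\<^sup>2 p)\<close> for large \<open>N\<close>, uniformly in \<open>p\<close>
  (lemmas \<open>abs_integral_prod_le\<close>, \<open>abs_integral_fluct_tuple_le\<close> and \<open>exp_log_power_le\<close>).
  The tuples are counted by adding one
  coordinate at a time (lemma \<open>sum_power_card_image_le\<close>).

  The operators are studied on the law \<open>D\<close> of the whole configuration.  The only consequence of
  independence that enters is that \<open>D\<close> is unchanged when some coordinates of a configuration are
  replaced by those of an independent copy; this is the locale \<open>resampling\<close>.  On bounded measurable
  functions the operators then commute without exceptional null sets, and the almost surely bounded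
  functions of the theorem are reduced to this case by truncation.
\<close>

section \<open>Elementary estimates for products and tuples\<close>

text \<open>
  The form of the summands matters: exactly one difference \<open>a k - b k\<close> occurs in each, whereas
  multiplying out would produce summands with many of them.
\<close>

lemma prod_telescope:
  fixes a b :: "'k::linorder \<Rightarrow> 'r::comm_ring_1"
  assumes "finite L"
  shows "(\<Prod>l\<in>L. a l) - (\<Prod>l\<in>L. b l)
      = (\<Sum>k\<in>L. \<Prod>l\<in>L. if l < k then b l else if l = k then a l - b l else a l)"
  using assms
proof (induction L rule: finite_linorder_max_induct)
  case (insert m L)
  have m: "m \<notin> L" "\<And>l. l \<in> L \<Longrightarrow> l < m" "\<And>l. l \<in> L \<Longrightarrow> l \<noteq> m" "\<And>l. l \<in> L \<Longrightarrow> \<not> m < l"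
    using insert by force+
  have "(\<Sum>k\<in>insert m L. \<Prod>l\<in>insert m L. if l < k then b l else if l = k then a l - b l else a l)
      = (a m - b m) * (\<Prod>l\<in>L. b l)
        + (\<Sum>k\<in>L. a m * (\<Prod>l\<in>L. if l < k then b l else if l = k then a l - b l else a l))"
    using insert.hyps m by (auto simp: sum.insert intro!: arg_cong2[of _ _ _ _ "(+)"] arg_cong2[of _ _ _ _ "(*)"] sum.cong prod.cong)
  also have "\<dots> = (a m - b m) * (\<Prod>l\<in>L. b l) + a m * ((\<Prod>l\<in>L. a l) - (\<Prod>l\<in>L. b l))"
    by (simp add: insert.IH sum_distrib_left)
  finally show ?case
    using insert.hyps m by (simp add: algebra_simps)
qed simp

text \<open>
  When a product of sums is multiplied out, every term but one contains some \<open>h k\<close>.  Keeping a single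
  one of them and bounding the rest by \<open>M\<close> gives one error term for each \<open>k\<close> instead of one for each
  nonempty set of positions.
\<close>

lemma abs_prod_le_main_plus_error:
  fixes f g h M :: "'k \<Rightarrow> real"
  assumes "finite K"
    and "\<And>k. k \<in> K \<Longrightarrow> \<bar>f k\<bar> \<le> g k + \<bar>h k\<bar>" and "\<And>k. k \<in> K \<Longrightarrow> \<bar>f k\<bar> \<le> M k"
    and "\<And>k. k \<in> K \<Longrightarrow> 0 \<le> g k" and "\<And>k. k \<in> K \<Longrightarrow> g k \<le> M k"
  shows "\<bar>\<Prod>k\<in>K. f k\<bar> \<le> (\<Prod>k\<in>K. g k) + (\<Sum>k\<in>K. \<bar>h k\<bar> * (\<Prod>l\<in>K - {k}. M l))"
  using assms
proof (induction K rule: finite_induct)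
  case (insert k K)
  define P where "P = \<bar>\<Prod>l\<in>K. f l\<bar>"
  define E where "E = (\<Sum>l\<in>K. \<bar>h l\<bar> * (\<Prod>l\<in>K - {l}. M l))"
  have M: "0 \<le> M l" if "l \<in> insert k K" for l
    using insert.prems(3,4)[OF that] by linarith
  have E: "0 \<le> E" unfolding E_def using M by (intro sum_nonneg mult_nonneg_nonneg prod_nonneg) auto
  have IH: "P \<le> (\<Prod>l\<in>K. g l) + E"
    unfolding P_def E_def by (rule insert.IH) (use insert.prems in auto)
  have P: "P \<le> (\<Prod>l\<in>K. M l)"
    unfolding P_def abs_prod using insert.prems(2) by (intro prod_mono) auto
  have P0: "0 \<le> P" by (simp add: P_def)
  have E': "(\<Sum>l\<in>K. \<bar>h l\<bar> * (\<Prod>l\<in>insert k K - {l}. M l)) = M k * E"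
  proof -
    have "(\<Prod>l\<in>insert k K - {l}. M l) = M k * (\<Prod>l\<in>K - {l}. M l)" if "l \<in> K" for l
    proof -
      have "insert k K - {l} = insert k (K - {l})" using that insert.hyps by auto
      then show ?thesis using insert.hyps by simp
    qed
    then show ?thesis by (simp add: E_def sum_distrib_left algebra_simps)
  qed
  have "\<bar>\<Prod>l\<in>insert k K. f l\<bar> = \<bar>f k\<bar> * P"
    using insert.hyps by (simp add: P_def abs_mult)
  also have "\<dots> \<le> (g k + \<bar>h k\<bar>) * P"
    using insert.prems(1)[of k] P0 by (intro mult_right_mono) auto
  also have "\<dots> = g k * P + \<bar>h k\<bar> * P" by (simp add: algebra_simps)
  also have "\<dots> \<le> g k * ((\<Prod>l\<in>K. g l) + E) + \<bar>h k\<bar> * (\<Prod>l\<in>K. M l)"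
    using insert.prems(3)[of k] IH P by (intro add_mono mult_left_mono) auto
  also have "\<dots> \<le> g k * (\<Prod>l\<in>K. g l) + M k * E + \<bar>h k\<bar> * (\<Prod>l\<in>K. M l)"
    using mult_right_mono[OF insert.prems(4)[of k] E] by (simp add: algebra_simps)
  also have "\<dots> = (\<Prod>l\<in>insert k K. g l) + (\<Sum>l\<in>insert k K. \<bar>h l\<bar> * (\<Prod>l\<in>insert k K - {l}. M l))"
    using insert.hyps by (simp add: E' Diff_insert_absorb)
  finally show ?case .
qed simp

text \<open>
  When a tuple is extended by one coordinate, at most \<open>n\<close> choices repeat a value and leave the image as
  it is, and at most \<open>card B\<close> choices enlarge it by one.
\<close>

lemma sum_power_card_image_le:
  fixes t :: real and B :: "'b set"
  assumes B: "finite B" and t: "0 \<le> t"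
  shows "(\<Sum>i\<in>{..<n} \<rightarrow>\<^sub>E B. t ^ card (i ` {..<n})) \<le> (\<Prod>k<n. real (card B) * t + real k)"
proof (induction n)
  case (Suc n)
  let ?F = "{..<n} \<rightarrow>\<^sub>E B"
  have one: "(\<Sum>y\<in>B. t ^ card (insert y R)) \<le> (real (card B) * t + real n) * t ^ card R"
    if R: "R \<subseteq> B" "card R \<le> n" for R
  proof -
    have fin: "finite R" using R B finite_subset by blast
    have "(\<Sum>y\<in>B. t ^ card (insert y R)) = (\<Sum>y\<in>B - R. t ^ card (insert y R)) + (\<Sum>y\<in>R. t ^ card (insert y R))"
      by (rule sum.subset_diff[OF R(1) B])
    also have "\<dots> = real (card (B - R)) * (t * t ^ card R) + real (card R) * t ^ card R"
      using fin by (simp add: insert_absorb)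
    also have "\<dots> \<le> real (card B) * (t * t ^ card R) + real n * t ^ card R"
      using R B t by (intro add_mono mult_right_mono) (auto intro!: card_mono)
    finally show ?thesis by (simp add: algebra_simps)
  qed
  have img: "i ` {..<n} \<subseteq> B" "card (i ` {..<n}) \<le> n" if "i \<in> ?F" for i
    using that card_image_le[of "{..<n}" i] by (auto simp: PiE_iff)
  have ne: "{..<n} \<inter> {x. x \<noteq> n} = {..<n}" by auto
  have "(\<Sum>i\<in>{..<Suc n} \<rightarrow>\<^sub>E B. t ^ card (i ` {..<Suc n}))
      = (\<Sum>(y, i)\<in>B \<times> ?F. t ^ card ((i(n := y)) ` {..<Suc n}))"
    unfolding lessThan_Suc PiE_insert_eq
    by (subst sum.reindex[OF inj_combinator]) (simp_all add: o_def case_prod_unfold ne)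
  also have "\<dots> = (\<Sum>i\<in>?F. \<Sum>y\<in>B. t ^ card ((i(n := y)) ` {..<Suc n}))"
    by (simp add: sum.cartesian_product[symmetric] sum.swap[of _ ?F B])
  also have "\<dots> = (\<Sum>i\<in>?F. \<Sum>y\<in>B. t ^ card (insert y (i ` {..<n})))"
  proof -
    have "(i(n := y)) ` {..<Suc n} = insert y (i ` {..<n})" for i and y :: 'b
      by (auto simp: lessThan_Suc)
    then show ?thesis by (simp only:)
  qed
  also have "\<dots> \<le> (\<Sum>i\<in>?F. (real (card B) * t + real n) * t ^ card (i ` {..<n}))"
    by (intro sum_mono one img)
  also have "\<dots> = (real (card B) * t + real n) * (\<Sum>i\<in>?F. t ^ card (i ` {..<n}))"
    by (simp add: sum_distrib_left)
  also have "\<dots> \<le> (real (card B) * t + real n) * (\<Prod>k<n. real (card B) * t + real k)"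
    using t by (intro mult_left_mono Suc.IH) auto
  finally show ?case by (simp add: mult.commute)
qed simp

text \<open>
  This is why one additional fluctuation for every value that occurs once suffices: afterwards every
  value is covered at least twice.
\<close>

lemma twice_card_image_le:
  assumes K: "finite K"
  shows "2 * card (i ` K) \<le> card K + card {v \<in> i ` K. card {k \<in> K. i k = v} = 1}"
proof -
  have "2 * card (i ` K) = (\<Sum>v\<in>i ` K. 2)" by simp
  also have "\<dots> \<le> (\<Sum>v\<in>i ` K. card {k \<in> K. i k = v} + (if card {k \<in> K. i k = v} = 1 then 1 else 0))"
  proof (intro sum_mono)
    fix v assume "v \<in> i ` K"
    then have "{k \<in> K. i k = v} \<noteq> {}" by auto
    then have "card {k \<in> K. i k = v} \<noteq> 0" using K by simp
    then show "2 \<le> card {k \<in> K. i k = v} + (if card {k \<in> K. i k = v} = 1 then 1 else 0)" by auto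
  qed
  also have "\<dots> = (\<Sum>v\<in>i ` K. card {k \<in> K. i k = v}) + card {v \<in> i ` K. card {k \<in> K. i k = v} = 1}"
    using K by (simp add: sum.distrib sum.If_cases Int_def)
  also have "(\<Sum>v\<in>i ` K. card {k \<in> K. i k = v}) = card K"
    using sum.image_gen[OF K, of "\<lambda>_. 1::nat" i] by simp
  finally show ?thesis by simp
qed

section \<open>Resampling coordinates of a product measure\<close>

definition resample :: "'i set \<Rightarrow> 'i set \<Rightarrow> ('i \<Rightarrow> 'b) \<Rightarrow> ('i \<Rightarrow> 'b) \<Rightarrow> ('i \<Rightarrow> 'b)"
  where "resample I U y z = (\<lambda>\<alpha>\<in>I. if \<alpha> \<in> U then z \<alpha> else y \<alpha>)"

lemma measurable_resample [measurable]:
  assumes [measurable]: "f \<in> measurable N (PiM I S)" "g \<in> measurable N (PiM I S)"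
  shows "(\<lambda>\<omega>. resample I U (f \<omega>) (g \<omega>)) \<in> measurable N (PiM I S)"
  unfolding resample_def
proof (rule measurable_restrict)
  fix \<alpha> assume \<alpha>: "\<alpha> \<in> I"
  have "(\<lambda>\<omega>. f \<omega> \<alpha>) \<in> measurable N (S \<alpha>)" "(\<lambda>\<omega>. g \<omega> \<alpha>) \<in> measurable N (S \<alpha>)"
    using \<alpha> by measurable
  then show "(\<lambda>\<omega>. if \<alpha> \<in> U then g \<omega> \<alpha> else f \<omega> \<alpha>) \<in> measurable N (S \<alpha>)"
    by (cases "\<alpha> \<in> U") auto
qed

text \<open>
  The preimage of a box under resampling is a product of two boxes, one constraining the
  coordinates outside \<open>U\<close> and the other those in \<open>U\<close>; together their measures have exactly the factors
  of the measure of the original box.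
\<close>

lemma distr_resample_PiM:
  fixes \<mu> :: "'i \<Rightarrow> 'b measure"
  assumes I: "finite I" and prob: "\<And>\<alpha>. prob_space (\<mu> \<alpha>)"
  defines "D \<equiv> PiM I \<mu>"
  shows "distr (D \<Otimes>\<^sub>M D) D (\<lambda>(y, z). resample I U y z) = D"
proof -
  interpret product_prob_space \<mu> I
    by (simp add: prob product_prob_space_def product_prob_space_axioms_def product_sigma_finite_def
        prob_space_imp_sigma_finite)
  interpret D: prob_space D
    unfolding D_def by (rule prob_space_PiM) (rule prob)
  have meas [measurable]: "(\<lambda>(y, z). resample I U y z) \<in> measurable (D \<Otimes>\<^sub>M D) D"
    unfolding D_def by measurable
  show ?thesis
    unfolding D_def
  proof (rule PiM_eqI[OF I])
    show "sets (distr (PiM I \<mu> \<Otimes>\<^sub>M PiM I \<mu>) (PiM I \<mu>) (\<lambda>(y, z). resample I U y z)) = sets (PiM I \<mu>)"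
      by simp
  next
    fix A assume A: "\<And>\<alpha>. \<alpha> \<in> I \<Longrightarrow> A \<alpha> \<in> sets (\<mu> \<alpha>)"
    define A1 where "A1 \<alpha> = (if \<alpha> \<in> U then space (\<mu> \<alpha>) else A \<alpha>)" for \<alpha>
    define A2 where "A2 \<alpha> = (if \<alpha> \<in> U then A \<alpha> else space (\<mu> \<alpha>))" for \<alpha>
    have AS: "\<alpha> \<in> I \<Longrightarrow> x \<in> A \<alpha> \<Longrightarrow> x \<in> space (\<mu> \<alpha>)" for \<alpha> x
      using A[THEN sets.sets_into_space] by blast
    have A12: "\<And>\<alpha>. \<alpha> \<in> I \<Longrightarrow> A1 \<alpha> \<in> sets (\<mu> \<alpha>)" "\<And>\<alpha>. \<alpha> \<in> I \<Longrightarrow> A2 \<alpha> \<in> sets (\<mu> \<alpha>)"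
      using A by (auto simp: A1_def A2_def)
    have box: "Pi\<^sub>E I A1 \<in> sets D" "Pi\<^sub>E I A2 \<in> sets D"
      unfolding D_def using A12 by (auto intro!: sets_PiM_I_finite I)
    have pre: "(\<lambda>(y, z). resample I U y z) -` Pi\<^sub>E I A \<inter> space (D \<Otimes>\<^sub>M D) = Pi\<^sub>E I A1 \<times> Pi\<^sub>E I A2"
      unfolding A1_def A2_def
      by (auto simp: D_def space_pair_measure space_PiM resample_def PiE_iff split: if_splits)
        (metis AS)+
    have "emeasure (distr (D \<Otimes>\<^sub>M D) D (\<lambda>(y, z). resample I U y z)) (Pi\<^sub>E I A)
        = emeasure (D \<Otimes>\<^sub>M D) (Pi\<^sub>E I A1 \<times> Pi\<^sub>E I A2)"
      unfolding pre[symmetric]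
      by (intro emeasure_distr meas) (auto simp: D_def intro!: sets_PiM_I_finite I A)
    also have "\<dots> = emeasure D (Pi\<^sub>E I A1) * emeasure D (Pi\<^sub>E I A2)"
      by (rule D.emeasure_pair_measure_Times[OF box])
    also have "\<dots> = (\<Prod>\<alpha>\<in>I. emeasure (\<mu> \<alpha>) (A1 \<alpha>) * emeasure (\<mu> \<alpha>) (A2 \<alpha>))"
      using A12 by (simp add: D_def emeasure_PiM[OF I] prod.distrib)
    also have "\<dots> = (\<Prod>\<alpha>\<in>I. emeasure (\<mu> \<alpha>) (A \<alpha>))"
      by (intro prod.cong refl) (auto simp: A1_def A2_def M.emeasure_space_1)
    finally show "emeasure (distr (PiM I \<mu> \<Otimes>\<^sub>M PiM I \<mu>) (PiM I \<mu>) (\<lambda>(y, z). resample I U y z)) (Pi\<^sub>E I A)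
        = (\<Prod>\<alpha>\<in>I. emeasure (\<mu> \<alpha>) (A \<alpha>))"
      by (simp add: D_def)
  qed
qed

lemma (in prob_space) config_measurable:
  assumes "indep_vars S x I"
  shows "config I x \<in> measurable M (PiM I S)"
  unfolding config_def
  using assms by (auto simp: indep_vars_def intro!: measurable_restrict)

lemma (in prob_space) distr_config_resample:
  assumes I: "finite I" and ind: "indep_vars S x I"
  defines "D \<equiv> distr M (PiM I S) (config I x)"
  shows "distr (D \<Otimes>\<^sub>M D) D (\<lambda>(y, z). resample I U y z) = D"
proof -
  have rv: "x \<alpha> \<in> measurable M (S \<alpha>)" if "\<alpha> \<in> I" for \<alpha>
    using ind that by (auto simp: indep_vars_def)
  \<comment> \<open>the values outside \<open>I\<close> only serve to make every \<open>\<mu>' \<alpha>\<close> a probability measure\<close>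
  define \<mu>' where "\<mu>' \<alpha> = (if \<alpha> \<in> I then distr M (S \<alpha>) (x \<alpha>) else return (count_space UNIV) undefined)" for \<alpha>
  have prob: "prob_space (\<mu>' \<alpha>)" for \<alpha>
    by (auto simp: \<mu>'_def intro!: prob_space_distr rv prob_space_return)
  have D_prob: "prob_space D"
    unfolding D_def by (rule prob_space_distr[OF config_measurable[OF ind]])
  have "D = PiM I \<mu>'"
  proof (cases "I = {}")
    case True
    interpret product_prob_space \<mu>' I
      by (simp add: prob product_prob_space_def product_prob_space_axioms_def product_sigma_finite_def
          prob_space_imp_sigma_finite)
    interpret D: prob_space D
      by (rule D_prob)
    show ?thesis
    proof (rule PiM_eqI[OF I])
      show "sets D = sets (PiM I \<mu>')" by (simp add: D_def True sets_PiM_empty)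
      have "space D = Pi\<^sub>E I A" for A by (simp add: D_def True space_PiM)
      then show "emeasure D (Pi\<^sub>E I A) = (\<Prod>i\<in>I. emeasure (\<mu>' i) (A i))" for A
        using D.emeasure_space_1 True by simp
    qed
  next
    case False
    have "D = PiM I (\<lambda>\<alpha>. distr M (S \<alpha>) (x \<alpha>))"
      using ind indep_vars_iff_distr_eq_PiM'[OF False, where M' = S and X = x] rv by (simp add: D_def config_def[abs_def])
    then show ?thesis
      by (simp add: \<mu>'_def cong: PiM_cong)
  qed
  then show ?thesis
    using distr_resample_PiM[OF I prob, where U = U] by simp
qed

lemma resample_resample:
  "resample I V (resample I U y z) w = resample I (U \<union> V) y (resample I V z w)"
  by (auto simp: resample_def fun_eq_iff)

lemma resample_overwrite:
  "resample I U (resample I U y z) w = resample I U y w"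
  by (auto simp: resample_def fun_eq_iff)

section \<open>Partial expectations of bounded measurable functions\<close>

text \<open>
  This is the product structure of \<open>D\<close> in the form in which it is used.  It avoids splitting the
  index set: an expectation over the coordinates in \<open>U\<close> integrates a complete independent
  copy, of which only those coordinates are read.
\<close>

locale resampling = prob_space D for D :: "('i \<Rightarrow> 'b) measure" +
  fixes I :: "'i set"
  assumes space_extensional: "space D \<subseteq> extensional I"
    and resample_measurable [measurable]:
      "\<And>U. (\<lambda>(y, z). resample I U y z) \<in> measurable (D \<Otimes>\<^sub>M D) D"
    and distr_resample: "\<And>U. distr (D \<Otimes>\<^sub>M D) D (\<lambda>(y, z). resample I U y z) = D"
begin

interpretation DD: pair_prob_space D D ..

lemma resample_space: "y \<in> space D \<Longrightarrow> z \<in> space D \<Longrightarrow> resample I U y z \<in> space D"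
  using measurable_space[OF resample_measurable, of "(y, z)"] by (simp add: space_pair_measure)

lemma resample_section [measurable]:
  "y \<in> space D \<Longrightarrow> (\<lambda>z. resample I U y z) \<in> measurable D D"
  using measurable_Pair2[OF resample_measurable, of y U] by simp

lemma AE_resample:
  assumes "AE y in D. P y"
  shows "AE y in D. AE z in D. P (resample I U y z)"
proof -
  have "AE q in D \<Otimes>\<^sub>M D. P (case q of (y, z) \<Rightarrow> resample I U y z)"
    by (rule AE_distrD[OF resample_measurable]) (unfold distr_resample, rule assms)
  from DD.AE_pair[OF this] show ?thesis by simp
qed

text \<open>
  The indicator makes the identities between iterated expectations below equalities of functions,
  not just equalities on \<open>space D\<close>, so that they can be used for rewriting.
\<close>

definition condE :: "'i set \<Rightarrow> (('i \<Rightarrow> 'b) \<Rightarrow> real) \<Rightarrow> ('i \<Rightarrow> 'b) \<Rightarrow> real"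
  where "condE U f y = indicator (space D) y * (\<integral>z. f (resample I U y z) \<partial>D)"

definition fluct :: "'i set \<Rightarrow> (('i \<Rightarrow> 'b) \<Rightarrow> real) \<Rightarrow> ('i \<Rightarrow> 'b) \<Rightarrow> real"
  where "fluct U f y = f y - condE U f y"

definition bounded_measurable :: "(('i \<Rightarrow> 'b) \<Rightarrow> real) set"
  where "bounded_measurable = {f \<in> borel_measurable D. \<exists>B. \<forall>y\<in>space D. \<bar>f y\<bar> \<le> B}"

lemma bm_measurable [measurable_dest]: "f \<in> bounded_measurable \<Longrightarrow> f \<in> borel_measurable D"
  by (simp add: bounded_measurable_def)

lemma bmI: "f \<in> borel_measurable D \<Longrightarrow> (\<And>y. y \<in> space D \<Longrightarrow> \<bar>f y\<bar> \<le> B) \<Longrightarrow> f \<in> bounded_measurable"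
  by (auto simp: bounded_measurable_def)

lemma bm_integrable: "f \<in> bounded_measurable \<Longrightarrow> integrable D f"
  unfolding bounded_measurable_def using integrable_const_bound[of f] by (auto simp: AE_I2)

lemma bm_const [simp]: "(\<lambda>y. c) \<in> bounded_measurable"
  by (rule bmI[of _ "\<bar>c\<bar>"]) auto

lemma bm_diff:
  assumes f: "f \<in> bounded_measurable" and g: "g \<in> bounded_measurable"
  shows "(\<lambda>y. f y - g y) \<in> bounded_measurable"
proof -
  obtain B C where "\<forall>y\<in>space D. \<bar>f y\<bar> \<le> B" "\<forall>y\<in>space D. \<bar>g y\<bar> \<le> C"
    using f g by (auto simp: bounded_measurable_def)
  then show ?thesis
    using f g by (intro bmI[of _ "B + C"]) (force dest: bm_measurable)+
qed

lemma bm_add: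
  assumes f: "f \<in> bounded_measurable" and g: "g \<in> bounded_measurable"
  shows "(\<lambda>y. f y + g y) \<in> bounded_measurable"
  using bm_diff[OF f bm_diff[OF bm_const[of 0] g]] by simp

lemma bm_mult:
  assumes f: "f \<in> bounded_measurable" and g: "g \<in> bounded_measurable"
  shows "(\<lambda>y. f y * g y) \<in> bounded_measurable"
proof -
  obtain B C where B: "\<forall>y\<in>space D. \<bar>f y\<bar> \<le> B" "\<forall>y\<in>space D. \<bar>g y\<bar> \<le> C"
    using f g by (auto simp: bounded_measurable_def)
  have "\<bar>f y * g y\<bar> \<le> \<bar>B\<bar> * \<bar>C\<bar>" if "y \<in> space D" for y
    unfolding abs_mult using B that by (intro mult_mono) (auto intro: order_trans)
  then show ?thesis
    using f g by (intro bmI[of _ "\<bar>B\<bar> * \<bar>C\<bar>"]) (auto dest: bm_measurable)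
qed

lemma bm_sum: "(\<And>k. k \<in> K \<Longrightarrow> F k \<in> bounded_measurable) \<Longrightarrow> (\<lambda>y. \<Sum>k\<in>K. F k y) \<in> bounded_measurable"
  by (induction K rule: infinite_finite_induct) (auto intro: bm_add)

lemma bm_prod: "(\<And>k. k \<in> K \<Longrightarrow> F k \<in> bounded_measurable) \<Longrightarrow> (\<lambda>y. \<Prod>k\<in>K. F k y) \<in> bounded_measurable"
  by (induction K rule: infinite_finite_induct) (auto intro: bm_mult)

lemma bm_abs: "f \<in> bounded_measurable \<Longrightarrow> (\<lambda>y. \<bar>f y\<bar>) \<in> bounded_measurable"
  unfolding bounded_measurable_def by auto

lemma bm_resample:
  assumes f: "f \<in> bounded_measurable" and y: "y \<in> space D"
  shows "(\<lambda>z. f (resample I U y z)) \<in> bounded_measurable"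
proof -
  obtain B where "\<And>y. y \<in> space D \<Longrightarrow> \<bar>f y\<bar> \<le> B" using f by (auto simp: bounded_measurable_def)
  then show ?thesis
    using f y by (intro bmI[of _ B] measurable_compose[OF resample_section])
      (auto intro: resample_space dest: bm_measurable)
qed

lemma condE_measurable [measurable]:
  assumes [measurable]: "f \<in> borel_measurable D"
  shows "condE U f \<in> borel_measurable D"
  unfolding condE_def by measurable

lemma abs_condE_le:
  assumes f: "f \<in> borel_measurable D" and B: "\<And>y. y \<in> space D \<Longrightarrow> \<bar>f y\<bar> \<le> B" and y: "y \<in> space D"
  shows "\<bar>condE U f y\<bar> \<le> B"
proof -
  have "f \<in> bounded_measurable" using bmI[OF f] B by blast
  then have int: "integrable D (\<lambda>z. \<bar>f (resample I U y z)\<bar>)"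
    by (intro bm_integrable bm_abs bm_resample y)
  have "\<bar>condE U f y\<bar> \<le> (\<integral>z. \<bar>f (resample I U y z)\<bar> \<partial>D)"
    using integral_abs_bound[of D "\<lambda>z. f (resample I U y z)"] y by (simp add: condE_def)
  also have "\<dots> \<le> B"
    by (rule integral_le_const[OF int]) (auto intro!: AE_I2 B resample_space y)
  finally show ?thesis .
qed

lemma condE_bm: assumes f: "f \<in> bounded_measurable" shows "condE U f \<in> bounded_measurable"
proof -
  obtain B where "\<And>y. y \<in> space D \<Longrightarrow> \<bar>f y\<bar> \<le> B" using f by (auto simp: bounded_measurable_def)
  then show ?thesis using f by (intro bmI[of _ B]) (auto intro!: abs_condE_le)
qed

lemma fluct_bm: "f \<in> bounded_measurable \<Longrightarrow> fluct U f \<in> bounded_measurable"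
  unfolding fluct_def by (intro bm_diff condE_bm)

lemma condE_diff:
  assumes "f \<in> bounded_measurable" "g \<in> bounded_measurable"
  shows "condE U (\<lambda>y. f y - g y) = (\<lambda>y. condE U f y - condE U g y)"
  using assms
  by (auto simp: condE_def fun_eq_iff indicator_def intro!: Bochner_Integration.integral_diff bm_integrable bm_resample)

lemma integrable_resample: "f \<in> bounded_measurable \<Longrightarrow> integrable (D \<Otimes>\<^sub>M D) (\<lambda>(y, z). f (resample I U y z))"
proof -
  assume f: "f \<in> bounded_measurable"
  have "integrable (D \<Otimes>\<^sub>M D) (\<lambda>q. f (case q of (y, z) \<Rightarrow> resample I U y z))"
    by (rule integrable_distr[OF resample_measurable])
      (simp add: distr_resample bm_integrable[OF f])
  then show ?thesis by (simp add: case_prod_unfold)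
qed

lemma integral_resample:
  assumes f: "f \<in> bounded_measurable"
  shows "(\<integral>y. (\<integral>z. f (resample I U y z) \<partial>D) \<partial>D) = (\<integral>y. f y \<partial>D)"
proof -
  have "(\<integral>y. (\<integral>z. f (resample I U y z) \<partial>D) \<partial>D) = (\<integral>q. f (case q of (y, z) \<Rightarrow> resample I U y z) \<partial>(D \<Otimes>\<^sub>M D))"
    using DD.integral_fst'[OF integrable_resample[OF f, of U]] by (simp add: case_prod_unfold)
  also have "\<dots> = (\<integral>y. f y \<partial>distr (D \<Otimes>\<^sub>M D) D (\<lambda>(y, z). resample I U y z))"
    using f by (intro integral_distr[symmetric]) auto
  finally show ?thesis by (simp add: distr_resample)
qed

text \<open>
  Resampling \<open>V\<close> after \<open>U\<close> from \<open>w\<close> and \<open>z\<close> is resampling \<open>U \<union> V\<close> once from the mixture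
  \<open>resample I V z w\<close>, and this mixture again has law \<open>D\<close>.  Idempotence and commutation of partial
  expectations are the special cases \<open>U = V\<close> and commutativity of the union.
\<close>

lemma condE_condE:
  assumes f: "f \<in> bounded_measurable"
  shows "condE U (condE V f) = condE (U \<union> V) f"
proof
  fix y show "condE U (condE V f) y = condE (U \<union> V) f y"
  proof (cases "y \<in> space D")
    case True
    have "condE U (condE V f) y = (\<integral>z. (\<integral>w. f (resample I (U \<union> V) y (resample I V z w)) \<partial>D) \<partial>D)"
      using True by (auto simp: condE_def resample_space resample_resample intro!: Bochner_Integration.integral_cong)
    also have "\<dots> = condE (U \<union> V) f y"
      using integral_resample[OF bm_resample[OF f True, of "U \<union> V"], of V] True by (simp add: condE_def)
    finally show ?thesis .
  qed (simp add: condE_def)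
qed

lemma condE_empty: "y \<in> space D \<Longrightarrow> condE {} f y = f y"
proof -
  assume y: "y \<in> space D"
  then have "resample I {} y z = y" for z
    using space_extensional by (auto simp: resample_def fun_eq_iff extensional_def)
  then show ?thesis using y by (simp add: condE_def prob_space)
qed

lemma integral_condE: "f \<in> bounded_measurable \<Longrightarrow> (\<integral>y. condE U f y \<partial>D) = (\<integral>y. f y \<partial>D)"
  unfolding integral_resample[symmetric, of f U]
  by (intro Bochner_Integration.integral_cong) (auto simp: condE_def)

section \<open>Products of fluctuations\<close>

lemma condE_zero [simp]: "condE U (\<lambda>y. 0) = (\<lambda>y. 0)"
  by (simp add: condE_def fun_eq_iff)

lemma fluct_alt: "fluct U f = (\<lambda>y. f y - condE U f y)"
  by (simp add: fluct_def fun_eq_iff)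

lemma condE_fluct:
  assumes "f \<in> bounded_measurable"
  shows "condE U (fluct V f) = fluct V (condE U f)"
  using assms by (simp add: fluct_alt condE_diff condE_bm condE_condE Un_commute)

lemma condE_fluct_same:
  assumes "f \<in> bounded_measurable"
  shows "condE U (fluct U f) = (\<lambda>y. 0)"
  using assms by (simp add: fluct_alt condE_diff condE_bm condE_condE)

lemma fluct_commute:
  assumes "f \<in> bounded_measurable"
  shows "fluct U (fluct V f) = fluct V (fluct U f)"
proof -
  have "fluct U (fluct V f) = (\<lambda>y. fluct V f y - condE U (fluct V f) y)"
    by (rule fluct_alt)
  also have "\<dots> = (\<lambda>y. (f y - condE V f y) - (condE U f y - condE (U \<union> V) f y))"
    using assms by (simp add: condE_fluct, simp add: fluct_alt condE_condE Un_commute)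
  also have "\<dots> = (\<lambda>y. fluct U f y - condE V (fluct U f) y)"
    using assms by (simp add: condE_fluct, simp add: fluct_alt condE_condE Un_commute algebra_simps)
  also have "\<dots> = fluct V (fluct U f)"
    by (rule fluct_alt[symmetric])
  finally show ?thesis .
qed

definition flucts :: "(nat \<Rightarrow> 'i set) \<Rightarrow> nat set \<Rightarrow> (('i \<Rightarrow> 'b) \<Rightarrow> real) \<Rightarrow> ('i \<Rightarrow> 'b) \<Rightarrow> real"
  where "flucts J A f = foldr (\<lambda>j. fluct (J j)) (sorted_list_of_set A) f"

lemma foldr_fluct_bm: "f \<in> bounded_measurable \<Longrightarrow> foldr (\<lambda>j. fluct (J j)) js f \<in> bounded_measurable"
  by (induction js) (auto intro: fluct_bm)

lemma flucts_bm: "f \<in> bounded_measurable \<Longrightarrow> flucts J A f \<in> bounded_measurable"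
  unfolding flucts_def by (rule foldr_fluct_bm)

lemma foldr_fluct_insort:
  assumes "f \<in> bounded_measurable"
  shows "foldr (\<lambda>j. fluct (J j)) (insort j js) f = fluct (J j) (foldr (\<lambda>j. fluct (J j)) js f)"
  by (induction js) (auto simp: fluct_commute foldr_fluct_bm assms)

lemma flucts_empty [simp]: "flucts J {} f = f"
  by (simp add: flucts_def)

lemma flucts_insert:
  "f \<in> bounded_measurable \<Longrightarrow> finite A \<Longrightarrow> j \<notin> A \<Longrightarrow> flucts J (insert j A) f = fluct (J j) (flucts J A f)"
  by (simp add: flucts_def sorted_list_of_set_insert foldr_fluct_insort)

lemma condE_flucts_eq_0:
  assumes "f \<in> bounded_measurable" "finite A" "j \<in> A"
  shows "condE (J j) (flucts J A f) = (\<lambda>y. 0)"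
  using assms flucts_insert[of f "A - {j}" j J]
  by (simp add: insert_absorb condE_fluct_same flucts_bm)

lemma abs_fluct_le:
  assumes f: "f \<in> bounded_measurable" and B: "\<And>y. y \<in> space D \<Longrightarrow> \<bar>f y\<bar> \<le> B" and y: "y \<in> space D"
  shows "\<bar>fluct U f y\<bar> \<le> 2 * B"
  using abs_condE_le[of f B y U] assms by (fastforce simp: fluct_def)

lemma abs_flucts_le:
  assumes f: "f \<in> bounded_measurable" and B: "\<And>y. y \<in> space D \<Longrightarrow> \<bar>f y\<bar> \<le> B" and A: "finite A"
  shows "y \<in> space D \<Longrightarrow> \<bar>flucts J A f y\<bar> \<le> 2 ^ card A * B"
  using A
proof (induction A arbitrary: y rule: finite_induct)
  case (insert j A)
  then show ?case
    using abs_fluct_le[of "flucts J A f" "2 ^ card A * B" y "J j"] by (simp add: flucts_insert f flucts_bm)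
qed (simp add: B)

lemma integral_abs_condE_le:
  assumes f: "f \<in> bounded_measurable"
  shows "(\<integral>y. \<bar>condE U f y\<bar> \<partial>D) \<le> (\<integral>y. \<bar>f y\<bar> \<partial>D)"
proof -
  have "\<bar>condE U f y\<bar> \<le> condE U (\<lambda>y. \<bar>f y\<bar>) y" for y
    using integral_abs_bound[of D "\<lambda>z. f (resample I U y z)"] by (simp add: condE_def indicator_def)
  then have "(\<integral>y. \<bar>condE U f y\<bar> \<partial>D) \<le> (\<integral>y. condE U (\<lambda>y. \<bar>f y\<bar>) y \<partial>D)"
    by (intro integral_mono bm_integrable bm_abs condE_bm f)
  then show ?thesis
    by (simp add: integral_condE bm_abs f)
qed

lemma integral_abs_flucts_le:
  assumes f: "f \<in> bounded_measurable" and A: "finite A"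
  shows "(\<integral>y. \<bar>flucts J A f y\<bar> \<partial>D) \<le> 2 ^ card A * (\<integral>y. \<bar>f y\<bar> \<partial>D)"
  using A
proof (induction A rule: finite_induct)
  case (insert j A)
  define g where "g = flucts J A f"
  have g: "g \<in> bounded_measurable" unfolding g_def by (rule flucts_bm[OF f])
  have "(\<integral>y. \<bar>fluct (J j) g y\<bar> \<partial>D) \<le> (\<integral>y. \<bar>g y\<bar> + \<bar>condE (J j) g y\<bar> \<partial>D)"
    by (intro integral_mono bm_integrable bm_add bm_abs condE_bm fluct_bm g) (simp add: fluct_def)
  also have "\<dots> = (\<integral>y. \<bar>g y\<bar> \<partial>D) + (\<integral>y. \<bar>condE (J j) g y\<bar> \<partial>D)"
    by (intro Bochner_Integration.integral_add bm_integrable bm_abs condE_bm g)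
  also have "\<dots> \<le> 2 * (\<integral>y. \<bar>g y\<bar> \<partial>D)"
    using integral_abs_condE_le[OF g, of "J j"] by simp
  finally show ?case
    using insert by (simp add: flucts_insert f g_def)
qed simp

text \<open>
  The values of \<open>condE U f\<close> at a single point depend on \<open>f\<close> on a slice, which may be a null set; but
  almost every slice meets the exceptional set of the assumption in a null set.
\<close>

lemma AE_condE_cong:
  assumes f: "f \<in> borel_measurable D" and g: "g \<in> borel_measurable D" and eq: "AE y in D. f y = g y"
  shows "AE y in D. condE U f y = condE U g y"
proof -
  from AE_resample[OF eq, of U] AE_space show ?thesis
  proof eventually_elim
    case (elim y)
    then show ?case
      using f g unfolding condE_def
      by (intro arg_cong2[of _ _ _ _ "(*)"] refl integral_cong_AE) (auto intro: measurable_compose[OF resample_section])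
  qed
qed

lemma AE_abs_condE_le:
  assumes f: "f \<in> bounded_measurable" and B: "AE y in D. \<bar>f y\<bar> \<le> B"
  shows "AE y in D. \<bar>condE U f y\<bar> \<le> B"
  using AE_resample[OF B, of U] AE_space
proof eventually_elim
  case (elim y)
  have "\<bar>condE U f y\<bar> \<le> (\<integral>z. \<bar>f (resample I U y z)\<bar> \<partial>D)"
    using integral_abs_bound[of D "\<lambda>z. f (resample I U y z)"] elim by (simp add: condE_def)
  also have "\<dots> \<le> B"
    using elim f by (intro integral_le_const bm_integrable bm_abs bm_resample) auto
  finally show ?case .
qed

text \<open>
  A partial expectation over \<open>U\<close> no longer depends on the coordinates in \<open>U\<close> and can be pulled out of
  the next one.
\<close>

lemma condE_mult_condE:
  "condE U (\<lambda>y. f y * (\<Prod>l\<in>L. condE U (g l) y)) = (\<lambda>y. condE U f y * (\<Prod>l\<in>L. condE U (g l) y))"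
proof
  fix y
  have *: "condE U (g l) (resample I U y z) = condE U (g l) y" if "y \<in> space D" "z \<in> space D" for l z
    using that by (simp add: condE_def resample_space resample_overwrite)
  show "condE U (\<lambda>y. f y * (\<Prod>l\<in>L. condE U (g l) y)) y = condE U f y * (\<Prod>l\<in>L. condE U (g l) y)"
  proof (cases "y \<in> space D")
    case True
    have "(\<integral>z. f (resample I U y z) * (\<Prod>l\<in>L. condE U (g l) (resample I U y z)) \<partial>D)
        = (\<integral>z. f (resample I U y z) * (\<Prod>l\<in>L. condE U (g l) y) \<partial>D)"
      by (intro Bochner_Integration.integral_cong refl) (simp add: * True)
    then show ?thesis
      using True by (subst (1 2) condE_def) simp
  qed (simp add: condE_def)
qed

lemma integral_mult_condE_eq_0:
  assumes f: "f \<in> bounded_measurable" and g: "\<And>l. l \<in> L \<Longrightarrow> g l \<in> bounded_measurable" and f0: "condE U f = (\<lambda>y. 0)"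
  shows "(\<integral>y. f y * (\<Prod>l\<in>L. condE U (g l) y) \<partial>D) = 0"
proof -
  have "(\<integral>y. f y * (\<Prod>l\<in>L. condE U (g l) y) \<partial>D)
      = (\<integral>y. condE U (\<lambda>y. f y * (\<Prod>l\<in>L. condE U (g l) y)) y \<partial>D)"
    by (intro integral_condE[symmetric] bm_mult bm_prod condE_bm f g)
  then show ?thesis
    by (simp add: condE_mult_condE f0)
qed

section \<open>Creating a second fluctuation for values that occur once\<close>

text \<open>
  Only the factor \<open>k0\<close> carries the fluctuation \<open>j\<close>.  With all other factors averaged over \<open>J j\<close> the
  integral would vanish.  Telescoping from the given factors to the averaged ones leaves, for every
  other \<open>k\<close>, a product in which \<open>k\<close> has acquired the fluctuation \<open>j\<close> and some further factors an average
  over \<open>J j\<close>.  The averages are harmless, which is why \<open>bound\<close> is required for arbitrary \<open>U'\<close>.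
\<close>

lemma abs_integral_prod_expand_one:
  fixes K :: "nat set"
  assumes K: "finite K" and z: "\<And>k. k \<in> K \<Longrightarrow> z k \<in> bounded_measurable" and A: "\<And>k. k \<in> K \<Longrightarrow> finite (A k)"
    and k0: "k0 \<in> K" "j \<in> A k0" and single: "\<And>k. k \<in> K \<Longrightarrow> k \<noteq> k0 \<Longrightarrow> j \<notin> A k"
    and bound: "\<And>k U'. k \<in> K \<Longrightarrow> k \<noteq> k0 \<Longrightarrow>
      \<bar>\<integral>y. (\<Prod>l\<in>K. condE (U' l) (flucts J ((A(k := insert j (A k))) l) (z l)) y) \<partial>D\<bar> \<le> b"
  shows "\<bar>\<integral>y. (\<Prod>k\<in>K. condE (U k) (flucts J (A k) (z k)) y) \<partial>D\<bar> \<le> real (card (K - {k0})) * b"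
proof -
  define L where "L = K - {k0}"
  define F where "F k = condE (U k) (flucts J (A k) (z k))" for k
  have L: "finite L" using K by (simp add: L_def)
  have Fbm: "F k \<in> bounded_measurable" if "k \<in> K" for k
    unfolding F_def by (intro condE_bm flucts_bm z that)
  have PF: "condE (J j) (F k) = condE (J j \<union> U k) (flucts J (A k) (z k))" if "k \<in> K" for k
    unfolding F_def by (intro condE_condE flucts_bm z that)
  have QF: "fluct (J j) (F k) = condE (U k) (flucts J (insert j (A k)) (z k))" if "k \<in> L" for k
    using that z A single unfolding F_def L_def by (simp add: condE_fluct[symmetric] flucts_bm flucts_insert)
  have F0: "condE (J j) (F k0) = (\<lambda>y. 0)"
  proof -
    have q: "flucts J (A k0) (z k0) \<in> bounded_measurable"
      by (intro flucts_bm z k0)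
    have "condE (J j) (F k0) = condE (U k0) (condE (J j) (flucts J (A k0) (z k0)))"
      by (simp add: F_def condE_condE q Un_commute)
    then show ?thesis
      using k0 z A by (simp add: condE_flucts_eq_0)
  qed
  define G where "G k l = (if l < k then condE (J j) (F l) else if l = k then fluct (J j) (F l) else F l)" for k l
  have Gbm: "G k l \<in> bounded_measurable" if "l \<in> K" for k l
    using Fbm[OF that] by (auto simp: G_def intro: condE_bm fluct_bm)
  have split: "(\<Prod>k\<in>K. F k y) = F k0 y * (\<Prod>l\<in>L. condE (J j) (F l) y) + (\<Sum>k\<in>L. F k0 y * (\<Prod>l\<in>L. G k l y))" for y
  proof -
    have "(\<Prod>k\<in>L. F k y) - (\<Prod>l\<in>L. condE (J j) (F l) y)
        = (\<Sum>k\<in>L. \<Prod>l\<in>L. G k l y)"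
      unfolding prod_telescope[OF L] G_def
      by (intro sum.cong prod.cong refl) (simp add: fluct_def)
    moreover have "(\<Prod>k\<in>K. F k y) = F k0 y * (\<Prod>k\<in>L. F k y)"
      unfolding L_def by (rule prod.remove) (use K k0 in auto)
    ultimately show ?thesis
      by (simp add: algebra_simps sum_distrib_left[symmetric])
  qed
  have LK: "l \<in> L \<Longrightarrow> l \<in> K" for l by (simp add: L_def)
  have "(\<integral>y. (\<Prod>k\<in>K. F k y) \<partial>D)
      = (\<integral>y. F k0 y * (\<Prod>l\<in>L. condE (J j) (F l) y) \<partial>D) + (\<Sum>k\<in>L. \<integral>y. F k0 y * (\<Prod>l\<in>L. G k l y) \<partial>D)"
    unfolding split
    by (subst Bochner_Integration.integral_add)
      (auto intro!: Bochner_Integration.integral_sum bm_integrable bm_mult bm_prod bm_sum condE_bm Fbm Gbm k0 dest: LK)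
  also have "(\<integral>y. F k0 y * (\<Prod>l\<in>L. condE (J j) (F l) y) \<partial>D) = 0"
    by (intro integral_mult_condE_eq_0 Fbm k0 F0) (auto dest: LK)
  finally have eq: "(\<integral>y. (\<Prod>k\<in>K. F k y) \<partial>D) = (\<Sum>k\<in>L. \<integral>y. F k0 y * (\<Prod>l\<in>L. G k l y) \<partial>D)" by simp
  have summand_le: "\<bar>\<integral>y. F k0 y * (\<Prod>l\<in>L. G k l y) \<partial>D\<bar> \<le> b" if k: "k \<in> L" for k
  proof -
    \<comment> \<open>Averages and fluctuations commute, so a term keeps the shape \<open>condE (U' l)\<close> after \<open>flucts\<close>.\<close>
    define U' where "U' l = (if l \<noteq> k0 \<and> l < k then J j \<union> U l else U l)" for l
    define A' where "A' = A(k := insert j (A k))"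
    have kk: "k \<in> K" "k \<noteq> k0" using k by (auto simp: L_def)
    have G: "G k l = condE (U' l) (flucts J (A' l) (z l))" if l: "l \<in> L" for l
      using l PF[OF LK[OF l]] QF[OF l] by (auto simp: G_def U'_def A'_def L_def) (auto simp: F_def)
    have "F k0 y * (\<Prod>l\<in>L. G k l y) = (\<Prod>l\<in>K. condE (U' l) (flucts J (A' l) (z l)) y)" for y
    proof -
      have "(\<Prod>l\<in>K. condE (U' l) (flucts J (A' l) (z l)) y)
          = condE (U' k0) (flucts J (A' k0) (z k0)) y * (\<Prod>l\<in>L. condE (U' l) (flucts J (A' l) (z l)) y)"
        unfolding L_def by (rule prod.remove) (use K k0 in auto)
      also have "condE (U' k0) (flucts J (A' k0) (z k0)) y = F k0 y"
        using kk by (simp add: F_def U'_def A'_def)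
      finally show ?thesis
        by (simp add: G cong: prod.cong)
    qed
    then show ?thesis
      using bound[OF kk, of U'] by (simp add: A'_def)
  qed
  have "\<bar>\<integral>y. (\<Prod>k\<in>K. F k y) \<partial>D\<bar> \<le> (\<Sum>k\<in>L. \<bar>\<integral>y. F k0 y * (\<Prod>l\<in>L. G k l y) \<partial>D\<bar>)"
    unfolding eq by (rule sum_abs)
  also have "\<dots> \<le> (\<Sum>k\<in>L. b)"
    by (intro sum_mono summand_le)
  finally show ?thesis
    by (simp add: F_def L_def)
qed

text \<open>
  One application of the previous lemma for every \<open>j \<in> T\<close>.  A fluctuation created for one \<open>j\<close> is
  that same \<open>j\<close>, so the remaining elements of \<open>T\<close> keep their unique position, and the number of
  fluctuations grows by exactly \<open>card T\<close>.
\<close>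

lemma abs_integral_prod_expand:
  fixes K :: "nat set"
  assumes T: "finite T" and K: "finite K" and z: "\<And>k. k \<in> K \<Longrightarrow> z k \<in> bounded_measurable"
    and A: "\<And>k. k \<in> K \<Longrightarrow> finite (A k)"
    and single: "\<And>j. j \<in> T \<Longrightarrow> \<exists>k0\<in>K. j \<in> A k0 \<and> (\<forall>k\<in>K - {k0}. j \<notin> A k)"
    and bound: "\<And>A' U. (\<And>k. k \<in> K \<Longrightarrow> A k \<subseteq> A' k \<and> A' k \<subseteq> A k \<union> T) \<Longrightarrow>
      (\<Sum>k\<in>K. card (A' k)) = (\<Sum>k\<in>K. card (A k)) + card T \<Longrightarrow>
      \<bar>\<integral>y. (\<Prod>k\<in>K. condE (U k) (flucts J (A' k) (z k)) y) \<partial>D\<bar> \<le> b"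
    and b: "0 \<le> b"
  shows "\<bar>\<integral>y. (\<Prod>k\<in>K. condE (U k) (flucts J (A k) (z k)) y) \<partial>D\<bar> \<le> real (card K) ^ card T * b"
  using T A single bound
proof (induction T arbitrary: A U rule: finite_induct)
  case empty
  have "\<bar>\<integral>y. (\<Prod>k\<in>K. condE (U k) (flucts J (A k) (z k)) y) \<partial>D\<bar> \<le> b"
    by (rule empty.prems(3)) auto
  then show ?case by simp
next
  case (insert j T)
  from insert.prems(2)[of j] obtain k0 where k0: "k0 \<in> K" "j \<in> A k0" "\<And>k. k \<in> K \<Longrightarrow> k \<noteq> k0 \<Longrightarrow> j \<notin> A k"
    by auto
  have "\<bar>\<integral>y. (\<Prod>k\<in>K. condE (U k) (flucts J (A k) (z k)) y) \<partial>D\<bar>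
      \<le> real (card (K - {k0})) * (real (card K) ^ card T * b)"
  proof (rule abs_integral_prod_expand_one[where A = A, OF K z insert.prems(1) k0])
    fix k U' assume k: "k \<in> K" "k \<noteq> k0"
    define A1 where "A1 = A(k := insert j (A k))"
    have A1: "finite (A1 l)" if "l \<in> K" for l
      using insert.prems(1)[OF that] insert.prems(1)[OF k(1)] by (simp add: A1_def)
    have sub: "A l \<subseteq> A1 l" "A1 l \<subseteq> A l \<union> {j}" for l by (auto simp: A1_def)
    have c: "(\<Sum>k\<in>K. card (A1 k)) = (\<Sum>k\<in>K. card (A k)) + 1"
    proof -
      have "(\<Sum>l\<in>K. card (A1 l)) = card (A1 k) + (\<Sum>l\<in>K - {k}. card (A1 l))"
        by (rule sum.remove) (use K k in auto)
      also have "\<dots> = Suc (card (A k)) + (\<Sum>l\<in>K - {k}. card (A l))"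
        using k k0(3) insert.prems(1) by (simp add: A1_def)
      also have "\<dots> = (\<Sum>l\<in>K. card (A l)) + 1"
        using sum.remove[OF K k(1), of "\<lambda>l. card (A l)"] by simp
      finally show ?thesis .
    qed
    show "\<bar>\<integral>y. (\<Prod>l\<in>K. condE (U' l) (flucts J ((A(k := insert j (A k))) l) (z l)) y) \<partial>D\<bar>
        \<le> real (card K) ^ card T * b"
      unfolding A1_def[symmetric]
    proof (rule insert.IH[OF A1])
      fix i assume i: "i \<in> T"
      then have "i \<noteq> j" using insert.hyps by auto
      then show "\<exists>k0\<in>K. i \<in> A1 k0 \<and> (\<forall>k\<in>K - {k0}. i \<notin> A1 k)"
        using insert.prems(2)[of i] i by (auto simp: A1_def)
    next
      fix A' U
      assume *: "\<And>k. k \<in> K \<Longrightarrow> A1 k \<subseteq> A' k \<and> A' k \<subseteq> A1 k \<union> T"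
        "(\<Sum>k\<in>K. card (A' k)) = (\<Sum>k\<in>K. card (A1 k)) + card T"
      show "\<bar>\<integral>y. (\<Prod>k\<in>K. condE (U k) (flucts J (A' k) (z k)) y) \<partial>D\<bar> \<le> b"
      proof (rule insert.prems(3))
        show "A k \<subseteq> A' k \<and> A' k \<subseteq> A k \<union> insert j T" if "k \<in> K" for k
          using *(1)[OF that] sub[of k] by blast
        show "(\<Sum>k\<in>K. card (A' k)) = (\<Sum>k\<in>K. card (A k)) + card (insert j T)"
          using *(2) c insert.hyps by simp
      qed
    qed
  qed
  also have "\<dots> \<le> real (card K) * (real (card K) ^ card T * b)"
    using K b by (intro mult_right_mono) (auto intro!: card_mono)
  finally show ?case
    using insert.hyps by (simp add: mult.assoc)
qed

section \<open>Moments of averaged fluctuations\<close>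

lemma abs_integral_prod_le:
  fixes F H :: "'k \<Rightarrow> ('i \<Rightarrow> 'b) \<Rightarrow> real"
  assumes K: "finite K" and F: "\<And>k. k \<in> K \<Longrightarrow> F k \<in> bounded_measurable" and H: "\<And>k. k \<in> K \<Longrightarrow> H k \<in> bounded_measurable"
    and main: "\<And>k. k \<in> K \<Longrightarrow> AE y in D. \<bar>F k y - H k y\<bar> \<le> g k"
    and bd: "\<And>k y. k \<in> K \<Longrightarrow> y \<in> space D \<Longrightarrow> \<bar>F k y\<bar> \<le> M k"
    and err: "\<And>k. k \<in> K \<Longrightarrow> (\<integral>y. \<bar>H k y\<bar> \<partial>D) \<le> \<delta> * M k"
    and g: "\<And>k. k \<in> K \<Longrightarrow> 0 \<le> g k" "\<And>k. k \<in> K \<Longrightarrow> g k \<le> M k"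
  shows "\<bar>\<integral>y. (\<Prod>k\<in>K. F k y) \<partial>D\<bar> \<le> (\<Prod>k\<in>K. g k) + real (card K) * \<delta> * (\<Prod>k\<in>K. M k)"
proof -
  have M: "0 \<le> M k" if "k \<in> K" for k using g[OF that] by linarith
  have "\<bar>\<integral>y. (\<Prod>k\<in>K. F k y) \<partial>D\<bar> \<le> (\<integral>y. \<bar>\<Prod>k\<in>K. F k y\<bar> \<partial>D)"
    by (rule integral_abs_bound)
  also have "\<dots> \<le> (\<integral>y. (\<Prod>k\<in>K. g k) + (\<Sum>k\<in>K. \<bar>H k y\<bar> * (\<Prod>l\<in>K - {k}. M l)) \<partial>D)"
  proof (rule integral_mono_AE)
    show "integrable D (\<lambda>y. \<bar>\<Prod>k\<in>K. F k y\<bar>)"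
      by (intro bm_integrable bm_abs bm_prod F)
    show "integrable D (\<lambda>y. (\<Prod>k\<in>K. g k) + (\<Sum>k\<in>K. \<bar>H k y\<bar> * (\<Prod>l\<in>K - {k}. M l)))"
      by (intro bm_integrable bm_add bm_sum bm_mult bm_abs bm_const H)
    have "AE y in D. \<forall>k\<in>K. \<bar>F k y - H k y\<bar> \<le> g k"
      using main K by (simp add: AE_finite_all)
    then show "AE y in D. \<bar>\<Prod>k\<in>K. F k y\<bar> \<le> (\<Prod>k\<in>K. g k) + (\<Sum>k\<in>K. \<bar>H k y\<bar> * (\<Prod>l\<in>K - {k}. M l))"
      using AE_space
    proof eventually_elim
      case (elim y)
      then have "\<bar>F k y\<bar> \<le> g k + \<bar>H k y\<bar>" if "k \<in> K" for k
        using that by fastforce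
      then show ?case
        using elim bd g by (intro abs_prod_le_main_plus_error K) auto
    qed
  qed
  also have "\<dots> = (\<Prod>k\<in>K. g k) + (\<integral>y. (\<Sum>k\<in>K. \<bar>H k y\<bar> * (\<Prod>l\<in>K - {k}. M l)) \<partial>D)"
    by (subst Bochner_Integration.integral_add)
      (auto intro!: bm_integrable bm_sum bm_mult bm_abs H simp: prob_space)
  also have "(\<integral>y. (\<Sum>k\<in>K. \<bar>H k y\<bar> * (\<Prod>l\<in>K - {k}. M l)) \<partial>D)
      = (\<Sum>k\<in>K. (\<integral>y. \<bar>H k y\<bar> \<partial>D) * (\<Prod>l\<in>K - {k}. M l))"
    by (subst Bochner_Integration.integral_sum)
      (auto intro!: bm_integrable bm_mult bm_abs H)
  also have "(\<Prod>k\<in>K. g k) + (\<Sum>k\<in>K. (\<integral>y. \<bar>H k y\<bar> \<partial>D) * (\<Prod>l\<in>K - {k}. M l))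
      \<le> (\<Prod>k\<in>K. g k) + (\<Sum>k\<in>K. \<delta> * (\<Prod>k\<in>K. M k))"
  proof (intro add_left_mono sum_mono)
    fix k assume k: "k \<in> K"
    have "(\<integral>y. \<bar>H k y\<bar> \<partial>D) * (\<Prod>l\<in>K - {k}. M l) \<le> \<delta> * M k * (\<Prod>l\<in>K - {k}. M l)"
      using M by (intro mult_right_mono err k prod_nonneg) auto
    then show "(\<integral>y. \<bar>H k y\<bar> \<partial>D) * (\<Prod>l\<in>K - {k}. M l) \<le> \<delta> * (\<Prod>k\<in>K. M k)"
      using prod.remove[OF K k, of M] by (simp add: mult.assoc)
  qed
  finally show ?thesis by simp
qed

text \<open>
  The error \<open>H\<close> collects what the representation on \<open>\<Xi>\<close> leaves over and all of \<open>flucts J A z\<close> outside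
  \<open>\<Xi>\<close>.  The first part is small in \<open>L\<^sup>1\<close>, although it lives on \<open>\<Xi>\<close>, because \<open>flucts\<close> is
  bounded on \<open>L\<^sup>1\<close> and is applied to a function supported in the complement of \<open>\<Xi>\<close>.
\<close>

lemma flucts_main_error_split:
  assumes \<Xi>: "\<Xi> \<in> sets D" and z: "z \<in> bounded_measurable" and w: "w \<in> bounded_measurable" and A: "finite A"
    and zB: "\<And>y. y \<in> space D \<Longrightarrow> \<bar>z y\<bar> \<le> B" and wB: "\<And>y. y \<in> space D \<Longrightarrow> \<bar>w y\<bar> \<le> B" and B: "0 \<le> B"
    and eq: "AE y in D. indicator \<Xi> y * flucts J A z y
          = v y + indicator \<Xi> y * flucts J A (\<lambda>y. indicator (- \<Xi>) y * w y) y"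
    and v: "AE y in D. \<bar>v y\<bar> \<le> g"
  shows "\<exists>H\<in>bounded_measurable. (AE y in D. \<bar>flucts J A z y - H y\<bar> \<le> g) \<and>
    (\<integral>y. \<bar>H y\<bar> \<partial>D) \<le> prob (space D - \<Xi>) * (2 * 2 ^ card A * B)"
proof -
  define ind :: "('i \<Rightarrow> 'b) \<Rightarrow> real" where "ind = indicator (space D - \<Xi>)"
  have ind: "ind \<in> bounded_measurable"
    unfolding ind_def using \<Xi> by (intro bmI[of _ 1]) (auto simp: indicator_def)
  have iX: "indicator \<Xi> \<in> bounded_measurable"
    using \<Xi> by (intro bmI[of _ 1]) (auto simp: indicator_def)
  have w1: "(\<lambda>y. indicator (- \<Xi>) y * w y) \<in> bounded_measurable"
  proof -
    have "indicator (- \<Xi>) \<in> bounded_measurable"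
    proof (rule bmI[of _ 1])
      have "ind \<in> borel_measurable D \<longleftrightarrow> (indicator (- \<Xi>) :: _ \<Rightarrow> real) \<in> borel_measurable D"
        unfolding ind_def by (intro measurable_cong) (auto simp: indicator_def)
      then show "(indicator (- \<Xi>) :: _ \<Rightarrow> real) \<in> borel_measurable D"
        using ind bm_measurable by blast
    qed (auto simp: indicator_def)
    then show ?thesis by (intro bm_mult w)
  qed
  define q where "q = flucts J A z"
  define r where "r = flucts J A (\<lambda>y. indicator (- \<Xi>) y * w y)"
  have q: "q \<in> bounded_measurable" and r: "r \<in> bounded_measurable" unfolding q_def r_def by (intro flucts_bm z w1)+
  define H where "H y = indicator \<Xi> y * r y + ind y * q y" for y
  have H: "H \<in> bounded_measurable" unfolding H_def[abs_def] by (intro bm_add bm_mult iX ind q r)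
  have main: "AE y in D. \<bar>q y - H y\<bar> \<le> g"
    using eq v AE_space
  proof eventually_elim
    case (elim y)
    have "q y - H y = indicator \<Xi> y * q y - indicator \<Xi> y * r y"
      using elim by (auto simp: H_def ind_def indicator_def)
    then show ?case using elim by (simp add: q_def r_def)
  qed
  have intind: "(\<integral>y. c * ind y \<partial>D) = c * prob (space D - \<Xi>)" for c
    using \<Xi> by (simp add: ind_def)
  have qB: "\<bar>q y\<bar> \<le> 2 ^ card A * B" if "y \<in> space D" for y
    unfolding q_def by (rule abs_flucts_le[OF z zB A that])
  have "(\<integral>y. \<bar>r y\<bar> \<partial>D) \<le> 2 ^ card A * (\<integral>y. \<bar>indicator (- \<Xi>) y * w y\<bar> \<partial>D)"
    unfolding r_def by (rule integral_abs_flucts_le[OF w1 A])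
  also have "\<dots> \<le> 2 ^ card A * (\<integral>y. B * ind y \<partial>D)"
    using wB B by (intro mult_left_mono integral_mono bm_integrable bm_abs w1 bm_mult bm_const ind)
      (auto simp: ind_def indicator_def)
  finally have rI: "(\<integral>y. \<bar>r y\<bar> \<partial>D) \<le> 2 ^ card A * B * prob (space D - \<Xi>)"
    by (simp add: intind mult.assoc del: integral_mult_right_zero)
  have "(\<integral>y. \<bar>H y\<bar> \<partial>D) \<le> (\<integral>y. \<bar>r y\<bar> + 2 ^ card A * B * ind y \<partial>D)"
    using qB B by (intro integral_mono bm_integrable bm_abs H bm_add r bm_mult bm_const ind)
      (force simp: H_def ind_def indicator_def)
  also have "\<dots> = (\<integral>y. \<bar>r y\<bar> \<partial>D) + (\<integral>y. 2 ^ card A * B * ind y \<partial>D)"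
    by (intro Bochner_Integration.integral_add bm_integrable bm_abs r bm_mult bm_const ind)
  also have "\<dots> \<le> 2 ^ card A * B * prob (space D - \<Xi>) + 2 ^ card A * B * prob (space D - \<Xi>)"
    unfolding intind by (intro add_right_mono rI)
  also have "\<dots> = prob (space D - \<Xi>) * (2 * 2 ^ card A * B)" by simp
  finally show ?thesis
    using H main unfolding q_def by blast
qed

text \<open>
  Here \<open>T\<close> in the proof is the set of the values that occur once.  The expansion leads to products
  with \<open>p + card T\<close> fluctuations, which lies between \<open>2 * card (i ` {..<p})\<close> and \<open>2 * p\<close>: the lower bound
  is used for the powers of \<open>X < 1\<close>, the upper bound for the powers of quantities that are at least \<open>1\<close>.
\<close>

lemma abs_integral_fluct_tuple_le:
  fixes N p :: nat and C R X Y \<delta> :: real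
  assumes p: "0 < p" and C: "1 \<le> C" and R: "1 \<le> R" and X: "0 < X" "X < 1" and Y: "0 < Y" and \<delta>: "0 \<le> \<delta>"
    and z: "\<And>i. i \<in> {1..N} \<Longrightarrow> Z i \<in> bounded_measurable"
    and zB: "\<And>i y. i \<in> {1..N} \<Longrightarrow> y \<in> space D \<Longrightarrow> \<bar>Z i y\<bar> \<le> Y * R"
    and split: "\<And>A i. A \<subseteq> {1..N} \<Longrightarrow> i \<in> A \<Longrightarrow> card A \<le> p \<Longrightarrow>
       \<exists>H\<in>bounded_measurable. (AE y in D. \<bar>flucts J A (Z i) y - H y\<bar> \<le> Y * (C * X * real (card A)) ^ card A) \<and>
         (\<integral>y. \<bar>H y\<bar> \<partial>D) \<le> \<delta> * (2 * 2 ^ card A * (Y * R ^ card A))"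
    and i: "\<And>k. k < p \<Longrightarrow> i k \<in> {1..N}"
  shows "\<bar>\<integral>y. (\<Prod>k<p. fluct (J (i k)) (Z (i k)) y) \<partial>D\<bar>
    \<le> real p ^ p * (Y ^ p * (C * real p) ^ (2 * p) * (X\<^sup>2) ^ card (i ` {..<p})
        + real p * \<delta> * (Y ^ p * (4 * C * real p * R) ^ (2 * p)))" (is "_ \<le> _ * ?b")
proof -
  define K where "K = {..<p}"
  define T where "T = {v \<in> i ` K. card {k \<in> K. i k = v} = 1}"
  define A0 where "A0 k = {i k}" for k
  have K: "finite K" "card K = p" by (auto simp: K_def)
  have T: "finite T" "card T \<le> p"
  proof -
    show "finite T" by (simp add: T_def K)
    have "card T \<le> card (i ` K)" by (rule card_mono) (auto simp: T_def K)
    also have "\<dots> \<le> p" using card_image_le[OF K(1), of i] K by simp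
    finally show "card T \<le> p" .
  qed
  have T2: "2 * card (i ` K) \<le> p + card T"
    using twice_card_image_le[OF K(1), of i] by (simp add: T_def K)
  have p1: "1 \<le> real p" using p by simp
  have Cp1: "1 \<le> C * real p" using mult_mono[OF C p1] C by simp
  have big1: "1 \<le> 4 * C * real p * R"
    using mult_mono[OF Cp1 R] Cp1 R by simp
  have b0: "0 \<le> ?b"
    using C R Y \<delta> X by (intro add_nonneg_nonneg mult_nonneg_nonneg) auto
  have iK: "k \<in> K \<Longrightarrow> i k \<in> {1..N}" for k using i by (simp add: K_def)
  have "\<bar>\<integral>y. (\<Prod>k\<in>K. condE {} (flucts J (A0 k) (Z (i k))) y) \<partial>D\<bar> \<le> real (card K) ^ card T * ?b"
  proof (rule abs_integral_prod_expand[OF T(1) K(1) _ _ _ _ b0])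
    show "Z (i k) \<in> bounded_measurable" if "k \<in> K" for k by (intro z iK that)
    show "finite (A0 k)" for k by (simp add: A0_def)
    show "\<exists>k0\<in>K. j \<in> A0 k0 \<and> (\<forall>k\<in>K - {k0}. j \<notin> A0 k)" if j: "j \<in> T" for j
    proof -
      from j obtain k0 where k0: "{k \<in> K. i k = j} = {k0}"
        by (auto simp: T_def card_1_singleton_iff)
      then show ?thesis by (intro bexI[of _ k0]) (auto simp: A0_def)
    qed
  next
    fix A' U
    assume A': "\<And>k. k \<in> K \<Longrightarrow> A0 k \<subseteq> A' k \<and> A' k \<subseteq> A0 k \<union> T"
      and "(\<Sum>k\<in>K. card (A' k)) = (\<Sum>k\<in>K. card (A0 k)) + card T"
    then have n: "(\<Sum>k\<in>K. card (A' k)) = p + card T" by (simp add: A0_def K)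
    have sub: "A' k \<subseteq> i ` K" if "k \<in> K" for k
      using A'[OF that] that by (auto simp: A0_def T_def)
    have fin: "finite (A' k)" if "k \<in> K" for k
      using sub[OF that] finite_subset K by blast
    have cp: "card (A' k) \<le> p" if "k \<in> K" for k
      using card_mono[OF _ sub[OF that]] card_image_le[OF K(1), of i] K by simp
    have c1: "1 \<le> card (A' k)" if "k \<in> K" for k
      using A'[OF that] fin[OF that] by (simp add: A0_def Suc_le_eq card_gt_0_iff) auto
    have subN: "A' k \<subseteq> {1..N}" if "k \<in> K" for k
      using sub[OF that] iK by blast
    have "\<forall>k\<in>K. \<exists>H\<in>bounded_measurable. (AE y in D. \<bar>flucts J (A' k) (Z (i k)) y - H y\<bar> \<le> Y * (C * X * real (card (A' k))) ^ card (A' k)) \<and>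
         (\<integral>y. \<bar>H y\<bar> \<partial>D) \<le> \<delta> * (2 * 2 ^ card (A' k) * (Y * R ^ card (A' k)))"
      using split[OF subN _ cp] A' by (auto simp: A0_def)
    then have "\<exists>H. \<forall>k\<in>K. H k \<in> bounded_measurable \<and> (AE y in D. \<bar>flucts J (A' k) (Z (i k)) y - H k y\<bar> \<le> Y * (C * X * real (card (A' k))) ^ card (A' k)) \<and>
         (\<integral>y. \<bar>H k y\<bar> \<partial>D) \<le> \<delta> * (2 * 2 ^ card (A' k) * (Y * R ^ card (A' k)))"
      unfolding Bex_def by (rule bchoice)
    then obtain H where H: "\<And>k. k \<in> K \<Longrightarrow> H k \<in> bounded_measurable"
      "\<And>k. k \<in> K \<Longrightarrow> AE y in D. \<bar>flucts J (A' k) (Z (i k)) y - H k y\<bar> \<le> Y * (C * X * real (card (A' k))) ^ card (A' k)"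
      "\<And>k. k \<in> K \<Longrightarrow> (\<integral>y. \<bar>H k y\<bar> \<partial>D) \<le> \<delta> * (2 * 2 ^ card (A' k) * (Y * R ^ card (A' k)))"
      by blast
    define g where "g k = Y * (C * real p * X) ^ card (A' k)" for k
    \<comment> \<open>One bound \<open>M\<close> serves for the supremum of a factor, its main part and, up to \<open>\<delta>\<close>, its error:
        the base \<open>4\<close> absorbs the factor \<open>2\<close> of each fluctuation and the two parts of the error.\<close>
    define M where "M k = Y * (4 * C * real p * R) ^ card (A' k)" for k
    have big: "2 * 2 ^ a * (Y * R ^ a) \<le> Y * (4 * C * real p * R) ^ a" if "1 \<le> a" for a :: nat
    proof -
      have "2 * 2 ^ a * R ^ a \<le> 2 ^ a * 2 ^ a * R ^ a"
        using power_increasing[OF that, of "2::real"] R by (intro mult_right_mono) auto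
      also have "\<dots> = (2 * 2 * R) ^ a" by (simp only: power_mult_distrib)
      also have "\<dots> = (4 * R) ^ a" by simp
      also have "\<dots> \<le> (4 * C * real p * R) ^ a"
        using mult_right_mono[OF Cp1, of "4 * R"] R by (intro power_mono) (auto simp: algebra_simps)
      finally show ?thesis using Y by (simp add: algebra_simps)
    qed
    have "\<bar>\<integral>y. (\<Prod>k\<in>K. condE (U k) (flucts J (A' k) (Z (i k))) y) \<partial>D\<bar>
        \<le> (\<Prod>k\<in>K. g k) + real (card K) * \<delta> * (\<Prod>k\<in>K. M k)"
    proof (rule abs_integral_prod_le[OF K(1), where H = "\<lambda>k. condE (U k) (H k)"])
      fix k assume k: "k \<in> K"
      let ?q = "flucts J (A' k) (Z (i k))"
      have q: "?q \<in> bounded_measurable" by (intro flucts_bm z iK k)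
      show "condE (U k) ?q \<in> bounded_measurable" by (intro condE_bm q)
      show "condE (U k) (H k) \<in> bounded_measurable" by (intro condE_bm H k)
      have "(C * X * real (card (A' k))) ^ card (A' k) \<le> (C * real p * X) ^ card (A' k)"
        using mult_left_mono[of "real (card (A' k))" "real p" "C * X"] X C cp[OF k]
        by (intro power_mono) (auto simp: algebra_simps)
      then have gle: "Y * (C * X * real (card (A' k))) ^ card (A' k) \<le> g k"
        using Y by (simp add: g_def)
      have "AE y in D. \<bar>condE (U k) (\<lambda>y. ?q y - H k y) y\<bar> \<le> Y * (C * X * real (card (A' k))) ^ card (A' k)"
        by (intro AE_abs_condE_le bm_diff q H k)
      then show "AE y in D. \<bar>condE (U k) ?q y - condE (U k) (H k) y\<bar> \<le> g k"
        using gle by (simp add: condE_diff q H k) (auto elim: eventually_mono)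
      show "0 \<le> g k" using X C Y by (simp add: g_def)
      have "C * real p * X \<le> 4 * C * real p * R"
        using mult_left_mono[of X "4 * R" "C * real p"] Cp1 R X by (simp add: algebra_simps)
      then show "g k \<le> M k"
        unfolding g_def M_def using X C Y by (intro mult_left_mono power_mono) auto
      have "(\<integral>y. \<bar>condE (U k) (H k) y\<bar> \<partial>D) \<le> (\<integral>y. \<bar>H k y\<bar> \<partial>D)"
        by (intro integral_abs_condE_le H k)
      also have "\<dots> \<le> \<delta> * M k"
        unfolding M_def by (rule order_trans[OF H(3)[OF k]]) (intro mult_left_mono big c1 k \<delta>)
      finally show "(\<integral>y. \<bar>condE (U k) (H k) y\<bar> \<partial>D) \<le> \<delta> * M k" .
      fix y assume y: "y \<in> space D"
      have "\<bar>condE (U k) ?q y\<bar> \<le> 2 ^ card (A' k) * (Y * R)"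
        using q y by (intro abs_condE_le abs_flucts_le[OF z[OF iK[OF k]] zB[OF iK[OF k]] fin[OF k]]) auto
      also have "\<dots> \<le> 2 * 2 ^ card (A' k) * (Y * R ^ card (A' k))"
        using power_increasing[OF c1[OF k] R] Y R by (intro mult_mono) auto
      also have "\<dots> \<le> M k" unfolding M_def by (intro big c1 k)
      finally show "\<bar>condE (U k) ?q y\<bar> \<le> M k" .
    qed
    also have "(\<Prod>k\<in>K. g k) = Y ^ p * (C * real p * X) ^ (p + card T)"
      by (simp add: g_def prod.distrib K power_sum[symmetric] n)
    also have "(\<Prod>k\<in>K. M k) = Y ^ p * (4 * C * real p * R) ^ (p + card T)"
      by (simp add: M_def prod.distrib K power_sum[symmetric] n)
    also have "Y ^ p * (C * real p * X) ^ (p + card T) \<le> Y ^ p * ((C * real p) ^ (2 * p) * (X\<^sup>2) ^ card (i ` K))"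
    proof -
      have "X ^ (p + card T) \<le> (X\<^sup>2) ^ card (i ` K)"
        unfolding power_mult[symmetric] using X T2 by (intro power_decreasing) auto
      moreover have "(C * real p) ^ (p + card T) \<le> (C * real p) ^ (2 * p)"
        using Cp1 T by (intro power_increasing) auto
      ultimately show ?thesis
        unfolding power_mult_distrib[of "C * real p" X] using X Y Cp1 by (intro mult_left_mono mult_mono) auto
    qed
    also have "real (card K) * \<delta> * (Y ^ p * (4 * C * real p * R) ^ (p + card T))
        \<le> real p * \<delta> * (Y ^ p * (4 * C * real p * R) ^ (2 * p))"
      unfolding K using big1 T Y \<delta> by (intro mult_left_mono power_increasing) auto
    finally show "\<bar>\<integral>y. (\<Prod>k\<in>K. condE (U k) (flucts J (A' k) (Z (i k))) y) \<partial>D\<bar> \<le> ?b"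
      by (simp add: K_def mult.assoc)
  qed
  also have "\<dots> \<le> real p ^ p * ?b"
    unfolding K using T p by (intro mult_right_mono b0 power_increasing) auto
  also have "(\<integral>y. (\<Prod>k\<in>K. condE {} (flucts J (A0 k) (Z (i k))) y) \<partial>D)
      = (\<integral>y. (\<Prod>k<p. fluct (J (i k)) (Z (i k)) y) \<partial>D)"
    by (intro Bochner_Integration.integral_cong refl)
      (simp add: condE_empty K_def A0_def flucts_def)
  finally show ?thesis .
qed

text \<open>
  Summing the weights \<open>(X\<^sup>2)\<close> to the power of the number of distinct values over all tuples gives at most
  \<open>(N X\<^sup>2 + p)\<^sup>p \<le> p\<^sup>p N\<^sup>p (X\<^sup>2 + 1/N)\<^sup>p\<close>, which accounts for the last of the four factors \<open>p\<^sup>p\<close>; one comes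
  from the expansion and two from \<open>(C p)\<^sup>2\<^sup>p\<close>.
\<close>

lemma fluct_average_moment_le:
  fixes N p :: nat and C R X Y \<delta> :: real
  assumes p: "0 < p" and N: "0 < N" and C: "1 \<le> C" and R: "1 \<le> R"
    and X: "0 < X" "X < 1" and Y: "0 < Y" and \<delta>: "0 \<le> \<delta>"
    and z: "\<And>i. i \<in> {1..N} \<Longrightarrow> Z i \<in> bounded_measurable"
    and zB: "\<And>i y. i \<in> {1..N} \<Longrightarrow> y \<in> space D \<Longrightarrow> \<bar>Z i y\<bar> \<le> Y * R"
    and split: "\<And>A i. A \<subseteq> {1..N} \<Longrightarrow> i \<in> A \<Longrightarrow> card A \<le> p \<Longrightarrow>
       \<exists>H\<in>bounded_measurable. (AE y in D. \<bar>flucts J A (Z i) y - H y\<bar> \<le> Y * (C * X * real (card A)) ^ card A) \<and>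
         (\<integral>y. \<bar>H y\<bar> \<partial>D) \<le> \<delta> * (2 * 2 ^ card A * (Y * R ^ card A))"
  shows "(\<integral>y. (1 / real N * (\<Sum>i=1..N. fluct (J i) (Z i) y)) ^ p \<partial>D)
    \<le> Y ^ p * (C ^ (2 * p) * real p ^ (4 * p) * (X\<^sup>2 + 1 / real N) ^ p
        + real p ^ p * real p * \<delta> * (4 * C * real p * R) ^ (2 * p))"
proof -
  define G where "G = {..<p} \<rightarrow>\<^sub>E {1..N}"
  define q where "q i = fluct (J i) (Z i)" for i
  define c1 where "c1 = real p ^ p * (Y ^ p * (C * real p) ^ (2 * p))"
  define c2 where "c2 = real p ^ p * (real p * \<delta> * (Y ^ p * (4 * C * real p * R) ^ (2 * p)))"
  have q: "q i \<in> bounded_measurable" if "i \<in> {1..N}" for i unfolding q_def by (intro fluct_bm z that)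
  have G: "finite G" "card G = N ^ p" by (auto simp: G_def card_PiE intro!: finite_PiE)
  have Gi: "i k \<in> {1..N}" if "i \<in> G" "k < p" for i k
    using PiE_mem[of i "{..<p}" "\<lambda>_. {1..N}" k] that by (simp add: G_def)
  have tuple_bm: "(\<lambda>y. \<Prod>k<p. q (i k) y) \<in> bounded_measurable" if "i \<in> G" for i
    using Gi[OF that] by (intro bm_prod q) simp
  have c10: "0 \<le> c1" using Y C by (simp add: c1_def)
  have expand: "(1 / real N * (\<Sum>i=1..N. q i y)) ^ p = (1 / real N) ^ p * (\<Sum>i\<in>G. \<Prod>k<p. q (i k) y)" for y
  proof -
    have "(\<Sum>i=1..N. q i y) ^ p = (\<Prod>k<p. \<Sum>i\<in>{1..N}. q i y)" by simp
    also have "\<dots> = (\<Sum>i\<in>G. \<Prod>k<p. q (i k) y)"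
      unfolding G_def by (rule prod_sum_PiE) auto
    finally show ?thesis by (simp only: power_mult_distrib)
  qed
  have "(\<integral>y. (1 / real N * (\<Sum>i=1..N. q i y)) ^ p \<partial>D)
      = (1 / real N) ^ p * (\<Sum>i\<in>G. \<integral>y. (\<Prod>k<p. q (i k) y) \<partial>D)"
    unfolding expand
    by (subst integral_mult_right_zero, subst Bochner_Integration.integral_sum)
      (auto intro: bm_integrable tuple_bm)
  also have "\<dots> \<le> (1 / real N) ^ p * (\<Sum>i\<in>G. c1 * (X\<^sup>2) ^ card (i ` {..<p}) + c2)"
  proof (intro mult_left_mono sum_mono)
    fix i assume i: "i \<in> G"
    show "(\<integral>y. (\<Prod>k<p. q (i k) y) \<partial>D) \<le> c1 * (X\<^sup>2) ^ card (i ` {..<p}) + c2"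
      using abs_integral_fluct_tuple_le[where i = i and Z = Z and J = J and N = N,
          OF p C R X Y \<delta> z zB split Gi[OF i]]
      by (simp add: q_def c1_def c2_def algebra_simps)
  qed simp
  also have "\<dots> = (1 / real N) ^ p * (c1 * (\<Sum>i\<in>G. (X\<^sup>2) ^ card (i ` {..<p}))) + c2"
    using N by (simp add: sum.distrib sum_distrib_left G field_simps)
  also have "\<dots> \<le> (1 / real N) ^ p * (c1 * (real p * (real N * X\<^sup>2 + 1)) ^ p) + c2"
  proof (intro add_right_mono mult_left_mono c10)
    have "(\<Sum>i\<in>G. (X\<^sup>2) ^ card (i ` {..<p})) \<le> (\<Prod>k<p. real N * X\<^sup>2 + real k)"
      unfolding G_def using sum_power_card_image_le[of "{1..N}" "X\<^sup>2" p] by simp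
    also have "\<dots> \<le> (\<Prod>k<p. real p * (real N * X\<^sup>2 + 1))"
    proof (intro prod_mono conjI)
      fix k assume "k \<in> {..<p}"
      moreover have "1 * (real N * X\<^sup>2) \<le> real p * (real N * X\<^sup>2)"
        using p by (intro mult_right_mono) auto
      ultimately show "real N * X\<^sup>2 + real k \<le> real p * (real N * X\<^sup>2 + 1)"
        by (simp add: distrib_left)
    qed simp
    finally show "(\<Sum>i\<in>G. (X\<^sup>2) ^ card (i ` {..<p})) \<le> (real p * (real N * X\<^sup>2 + 1)) ^ p" by simp
  qed simp
  also have "(1 / real N) ^ p * (c1 * (real p * (real N * X\<^sup>2 + 1)) ^ p)
      = c1 * real p ^ p * (X\<^sup>2 + 1 / real N) ^ p"
  proof -
    have "1 / real N * (real p * (real N * X\<^sup>2 + 1)) = real p * (X\<^sup>2 + 1 / real N)"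
      using N by (simp add: field_simps)
    then show ?thesis
      by (metis (no_types, opaque_lifting) mult.assoc mult.left_commute power_mult_distrib)
  qed
  also have "c1 * real p ^ p = Y ^ p * (C ^ (2 * p) * real p ^ (4 * p))"
  proof -
    have "real p ^ (4 * p) = real p ^ p * real p ^ (2 * p) * real p ^ p"
      by (simp add: power_add[symmetric])
    then show ?thesis by (simp add: c1_def power_mult_distrib)
  qed
  finally show ?thesis
    by (simp add: q_def c2_def algebra_simps)
qed

end

section \<open>Transfer to functions of independent random variables\<close>

lemma (in prob_space) resampling_distr_config:
  assumes I: "finite I" and ind: "indep_vars S x I"
  shows "resampling (distr M (PiM I S) (config I x)) I"
proof -
  let ?D = "distr M (PiM I S) (config I x)"
  have meas: "(\<lambda>(y, z). resample I U y z) \<in> measurable (?D \<Otimes>\<^sub>M ?D) ?D" for U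
  proof -
    have s: "sets ?D = sets (PiM I S)" by simp
    have "(\<lambda>(y, z). resample I U y z) \<in> measurable (PiM I S \<Otimes>\<^sub>M PiM I S) (PiM I S)"
      by measurable
    then show ?thesis
      by (simp cong: measurable_cong_sets sets_pair_measure_cong)
  qed
  show ?thesis
    unfolding resampling_def resampling_axioms_def
    using prob_space_distr[OF config_measurable[OF ind]] meas distr_config_resample[OF I ind]
    by (auto simp: space_PiM PiE_iff)
qed

text \<open>
  For a fixed configuration \<open>y\<close> the integrand depends on \<open>\<omega>\<close> only through the configuration at \<open>\<omega>\<close>, so
  the integral can be moved to the law of the configuration.
\<close>

lemma (in prob_space) partial_expectation_eq_condE:
  assumes I: "finite I" and ind: "indep_vars S x I"
    and f: "f \<in> borel_measurable (PiM I S)" and y: "y \<in> space (PiM I S)"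
  shows "partial_expectation M I x U f y
    = resampling.condE (distr M (PiM I S) (config I x)) I U f y"
proof -
  interpret R: resampling "distr M (PiM I S) (config I x)" I
    by (rule resampling_distr_config[OF I ind])
  have [measurable]: "config I x \<in> measurable M (PiM I S)"
    by (rule config_measurable[OF ind])
  have "partial_expectation M I x U f y = (\<integral>\<omega>. f (resample I U y (config I x \<omega>)) \<partial>M)"
    unfolding partial_expectation_def
    by (intro Bochner_Integration.integral_cong refl arg_cong[of _ _ f])
      (auto simp: resample_def config_def fun_eq_iff)
  also have "\<dots> = (\<integral>z. f (resample I U y z) \<partial>distr M (PiM I S) (config I x))"
  proof (rule integral_distr[symmetric])
    have "(\<lambda>z. resample I U y z) \<in> measurable (PiM I S) (PiM I S)"
      using y by measurable
    then show "(\<lambda>z. f (resample I U y z)) \<in> borel_measurable (PiM I S)"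
      using f by (rule measurable_compose)
  qed measurable
  finally show ?thesis
    using y by (simp add: R.condE_def)
qed

lemma (in prob_space) AE_Q_op_eq_fluct:
  assumes I: "finite I" and ind: "indep_vars S x I"
  defines "D \<equiv> distr M (PiM I S) (config I x)"
  assumes f: "f \<in> borel_measurable D" and g: "g \<in> borel_measurable D" and eq: "AE y in D. f y = g y"
  shows "Q_op M I x U f \<in> borel_measurable D"
    and "AE y in D. Q_op M I x U f y = resampling.fluct D I U g y"
proof -
  interpret R: resampling D I
    unfolding D_def by (rule resampling_distr_config[OF I ind])
  have op: "Q_op M I x U f y = R.fluct U f y" if "y \<in> space D" for y
  proof -
    have "partial_expectation M I x U f y = R.condE U f y"
      unfolding D_def by (rule partial_expectation_eq_condE[OF I ind]) (use f that in \<open>auto simp: D_def\<close>)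
    then show ?thesis by (simp add: Q_op_def R.fluct_def)
  qed
  have "Q_op M I x U f \<in> borel_measurable D \<longleftrightarrow> R.fluct U f \<in> borel_measurable D"
    by (rule measurable_cong) (rule op)
  then show "Q_op M I x U f \<in> borel_measurable D"
    using f by (simp add: R.fluct_alt)
  show "AE y in D. Q_op M I x U f y = R.fluct U g y"
    using R.AE_condE_cong[OF f g eq, of U] eq AE_space
    by eventually_elim (simp add: op R.fluct_def)
qed

text \<open>
  This allows a function to be truncated: \<open>f\<close> need only be bounded almost surely, while \<open>g\<close> is bounded, and
  the order in which \<open>Q_prod\<close> composes its operators becomes irrelevant.
\<close>

lemma (in prob_space) AE_Q_prod_eq_flucts:
  assumes I: "finite I" and ind: "indep_vars S x I"
  defines "D \<equiv> distr M (PiM I S) (config I x)"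
  assumes f: "f \<in> borel_measurable D" and g: "g \<in> resampling.bounded_measurable D" and eq: "AE y in D. f y = g y"
  shows "Q_prod M I x J A f \<in> borel_measurable D"
    and "AE y in D. Q_prod M I x J A f y = resampling.flucts D I J A g y"
proof -
  interpret R: resampling D I
    unfolding D_def by (rule resampling_distr_config[OF I ind])
  have "foldr (\<lambda>i. Q_op M I x (J i)) js f \<in> borel_measurable D \<and>
      (AE y in D. foldr (\<lambda>i. Q_op M I x (J i)) js f y = foldr (\<lambda>i. R.fluct (J i)) js g y)" for js
  proof (induction js)
    case (Cons j js)
    then show ?case
      using AE_Q_op_eq_fluct[OF I ind, folded D_def, of "foldr (\<lambda>i. Q_op M I x (J i)) js f"
          "foldr (\<lambda>i. R.fluct (J i)) js g" "J j"]
      by (simp add: R.foldr_fluct_bm[OF g] R.bm_measurable)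
  qed (use f eq in auto)
  then show "Q_prod M I x J A f \<in> borel_measurable D"
    and "AE y in D. Q_prod M I x J A f y = R.flucts J A g y"
    by (auto simp: Q_prod_def R.flucts_def)
qed

lemma pred_eq_real [measurable (raw)]:
  fixes f g :: "'c \<Rightarrow> real"
  assumes "f \<in> borel_measurable N" "g \<in> borel_measurable N"
  shows "Measurable.pred N (\<lambda>y. f y = g y)"
  unfolding pred_def using assms by (rule borel_measurable_eq)

definition clamp_to :: "real \<Rightarrow> real \<Rightarrow> real"
  where "clamp_to B t = max (- B) (min B t)"

lemma abs_clamp_to_le: "0 \<le> B \<Longrightarrow> \<bar>clamp_to B t\<bar> \<le> B"
  by (auto simp: clamp_to_def)

lemma clamp_to_eq: "\<bar>t\<bar> \<le> B \<Longrightarrow> clamp_to B t = t"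
  by (auto simp: clamp_to_def)

text \<open>
  Truncating \<open>Z\<close> and \<open>W\<close> at their almost sure bounds changes all the functions involved only on null
  sets, so that the moment bound for bounded functions applies.
\<close>

lemma (in prob_space) Q_average_moment_le:
  fixes N p :: nat and C R X Y :: real
  assumes p: "0 < p" and N: "0 < N" and C: "1 \<le> C" and R: "1 \<le> R"
    and X: "0 < X" "X < 1" and Y: "0 < Y"
    and I: "finite I" and ind: "indep_vars S x I"
    and Z: "\<And>i. i \<in> {1..N} \<Longrightarrow> Z i \<in> borel_measurable (PiM I S)"
    and \<Xi>: "\<Xi> \<in> sets (PiM I S)"
    and ZB: "\<And>i. i \<in> {1..N} \<Longrightarrow> AE \<omega> in M. \<bar>Z i (config I x \<omega>)\<bar> \<le> Y * R"
    and split: "\<And>A i. A \<subseteq> {1..N} \<Longrightarrow> i \<in> A \<Longrightarrow> card A \<le> p \<Longrightarrow>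
        (\<exists>V\<in>borel_measurable (PiM I S). \<exists>W\<in>borel_measurable (PiM I S).
          (AE \<omega> in M.
            indicator \<Xi> (config I x \<omega>) * Q_prod M I x J A (Z i) (config I x \<omega>)
              = V (config I x \<omega>)
                + indicator \<Xi> (config I x \<omega>)
                  * Q_prod M I x J A (\<lambda>y. indicator (- \<Xi>) y * W y) (config I x \<omega>)) \<and>
          (AE \<omega> in M. \<bar>V (config I x \<omega>)\<bar> \<le> Y * (C * X * real (card A)) ^ card A) \<and>
          (AE \<omega> in M. \<bar>W (config I x \<omega>)\<bar> \<le> Y * R ^ card A))"
  shows "(\<integral>\<omega>. (Q_average M I x J N Z (config I x \<omega>)) ^ p \<partial>M)
    \<le> Y ^ p * (C ^ (2 * p) * real p ^ (4 * p) * (X\<^sup>2 + 1 / real N) ^ p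
        + real p ^ p * real p * prob {\<omega> \<in> space M. config I x \<omega> \<notin> \<Xi>} * (4 * C * real p * R) ^ (2 * p))"
proof -
  define D where "D = distr M (PiM I S) (config I x)"
  interpret R: resampling D I
    unfolding D_def by (rule resampling_distr_config[OF I ind])
  have conf [measurable]: "config I x \<in> measurable M (PiM I S)"
    by (rule config_measurable[OF ind])
  have setsD [measurable_cong, simp]: "sets D = sets (PiM I S)" by (simp add: D_def)
  have measD: "borel_measurable D = (borel_measurable (PiM I S) :: (_ \<Rightarrow> real) set)"
    by (rule measurable_cong_sets) auto
  have AE_D: "AE y in D. P y" if "Measurable.pred D P" "AE \<omega> in M. P (config I x \<omega>)" for P
  proof -
    have "{y \<in> space (PiM I S). P y} \<in> sets (PiM I S)"
      using that(1) by (simp add: pred_def D_def)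
    from AE_distr_iff[OF conf this] that(2) show ?thesis unfolding D_def by blast
  qed
  define \<delta> where "\<delta> = R.prob (space D - \<Xi>)"
  have \<delta>: "\<delta> = prob {\<omega> \<in> space M. config I x \<omega> \<notin> \<Xi>}"
  proof -
    have "\<delta> = prob (config I x -` (space D - \<Xi>) \<inter> space M)"
      unfolding \<delta>_def unfolding D_def using \<Xi> by (intro measure_distr conf) auto
    also have "config I x -` (space D - \<Xi>) \<inter> space M = {\<omega> \<in> space M. config I x \<omega> \<notin> \<Xi>}"
      using measurable_space[OF conf] by (auto simp: D_def)
    finally show ?thesis .
  qed
  define Z' where "Z' i y = clamp_to (Y * R) (Z i y)" for i y
  have Z'_bm: "Z' i \<in> R.bounded_measurable" if "i \<in> {1..N}" for i
    using Z[OF that] Y R unfolding Z'_def[abs_def]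
    by (intro R.bmI[of _ "Y * R"] abs_clamp_to_le) (auto simp: measD clamp_to_def)
  have Z'B: "\<bar>Z' i y\<bar> \<le> Y * R" for i y
    unfolding Z'_def using Y R by (intro abs_clamp_to_le) auto
  have ZZ': "AE y in D. Z i y = Z' i y" if i: "i \<in> {1..N}" for i
  proof -
    have [measurable]: "Z i \<in> borel_measurable (PiM I S)" "Z' i \<in> borel_measurable (PiM I S)"
      using Z[OF i] R.bm_measurable[OF Z'_bm[OF i]] by (auto simp: measD)
    have "AE \<omega> in M. Z i (config I x \<omega>) = Z' i (config I x \<omega>)"
      using ZB[OF i] by eventually_elim (simp add: Z'_def clamp_to_eq)
    then show ?thesis by (rule AE_D[rotated]) measurable
  qed
  have Zm: "Z i \<in> borel_measurable D" if "i \<in> {1..N}" for i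
    using Z[OF that] by (simp add: measD)
  note Qp = AE_Q_prod_eq_flucts[OF I ind, folded D_def]
  have split': "\<exists>H\<in>R.bounded_measurable. (AE y in D. \<bar>R.flucts J A (Z' i) y - H y\<bar> \<le> Y * (C * X * real (card A)) ^ card A) \<and>
         (\<integral>y. \<bar>H y\<bar> \<partial>D) \<le> \<delta> * (2 * 2 ^ card A * (Y * R ^ card A))"
    if A: "A \<subseteq> {1..N}" "i \<in> A" "card A \<le> p" for A i
  proof -
    from split[OF A] obtain V W where
      Vm: "V \<in> borel_measurable D" and Wm: "W \<in> borel_measurable D" and
      VW: "AE \<omega> in M. indicator \<Xi> (config I x \<omega>) * Q_prod M I x J A (Z i) (config I x \<omega>)
              = V (config I x \<omega>) + indicator \<Xi> (config I x \<omega>)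
                  * Q_prod M I x J A (\<lambda>y. indicator (- \<Xi>) y * W y) (config I x \<omega>)" and
      V: "AE \<omega> in M. \<bar>V (config I x \<omega>)\<bar> \<le> Y * (C * X * real (card A)) ^ card A" and
      W: "AE \<omega> in M. \<bar>W (config I x \<omega>)\<bar> \<le> Y * R ^ card A"
      unfolding measD by blast
    note [measurable] = Vm Wm
    have i: "i \<in> {1..N}" using A by auto
    have finA: "finite A" using A(1) finite_subset by blast
    have cA: "1 \<le> card A" using A(2) finA by (auto simp: Suc_le_eq card_gt_0_iff)
    define W' where "W' y = clamp_to (Y * R ^ card A) (W y)" for y
    have B: "0 \<le> Y * R ^ card A" using Y R by simp
    have W'B: "\<bar>W' y\<bar> \<le> Y * R ^ card A" for y
      unfolding W'_def by (rule abs_clamp_to_le[OF B])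
    have W'm [measurable]: "W' \<in> borel_measurable D"
      unfolding W'_def[abs_def] clamp_to_def by measurable
    have W'bounded_measurable: "W' \<in> R.bounded_measurable"
      by (rule R.bmI[OF W'm W'B])
    have \<Xi>D [measurable]: "\<Xi> \<in> sets D" using \<Xi> by simp
    have cm: "(\<lambda>y. indicator (- \<Xi>) y * w y) \<in> borel_measurable D"
      if [measurable]: "w \<in> borel_measurable D" for w :: "_ \<Rightarrow> real"
    proof -
      have "(\<lambda>y. indicator (space D - \<Xi>) y * w y) \<in> borel_measurable D" by measurable
      moreover have "(\<lambda>y. indicator (space D - \<Xi>) y * w y) \<in> borel_measurable D
          \<longleftrightarrow> (\<lambda>y. indicator (- \<Xi>) y * w y) \<in> borel_measurable D"
        by (intro measurable_cong) (auto simp: indicator_def)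
      ultimately show ?thesis by simp
    qed
    have cbm: "(\<lambda>y. indicator (- \<Xi>) y * W' y) \<in> R.bounded_measurable"
      using W'B B by (intro R.bmI[OF cm[OF W'm], of "Y * R ^ card A"]) (auto simp: indicator_def)
    have "AE \<omega> in M. W (config I x \<omega>) = W' (config I x \<omega>)"
      using W by eventually_elim (simp add: W'_def clamp_to_eq)
    then have "AE y in D. W y = W' y"
      by (rule AE_D[rotated]) measurable
    then have cWW': "AE y in D. indicator (- \<Xi>) y * W y = indicator (- \<Xi>) y * W' y"
      by eventually_elim simp
    note QZ = Qp[OF Zm[OF i] Z'_bm[OF i] ZZ'[OF i], of J A]
    note QW = Qp[OF cm[OF Wm] cbm cWW', of J A]
    note [measurable] = QZ(1) QW(1)
    have "AE y in D. indicator \<Xi> y * Q_prod M I x J A (Z i) y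
        = V y + indicator \<Xi> y * Q_prod M I x J A (\<lambda>y. indicator (- \<Xi>) y * W y) y"
      using VW by (rule AE_D[rotated]) measurable
    with QZ(2) QW(2) have eq: "AE y in D. indicator \<Xi> y * R.flucts J A (Z' i) y
        = V y + indicator \<Xi> y * R.flucts J A (\<lambda>y. indicator (- \<Xi>) y * W' y) y"
      by eventually_elim simp
    have v: "AE y in D. \<bar>V y\<bar> \<le> Y * (C * X * real (card A)) ^ card A"
      using V by (rule AE_D[rotated]) measurable
    have "Y * R \<le> Y * R ^ card A"
      using power_increasing[OF cA R] Y by simp
    then have "\<bar>Z' i y\<bar> \<le> Y * R ^ card A" for y
      using Z'B[of i y] by linarith
    from R.flucts_main_error_split[OF \<Xi>D Z'_bm[OF i] W'bounded_measurable finA this W'B B eq v]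
    show ?thesis by (simp add: \<delta>_def)
  qed
  define avg where "avg y = 1 / real N * (\<Sum>i=1..N. R.fluct (J i) (Z' i) y)" for y
  have Qop: "Q_op M I x (J i) (Z i) \<in> borel_measurable D"
    "AE y in D. Q_op M I x (J i) (Z i) y = R.fluct (J i) (Z' i) y" if "i \<in> {1..N}" for i
    using AE_Q_op_eq_fluct[OF I ind, folded D_def, OF Zm[OF that] R.bm_measurable[OF Z'_bm[OF that]] ZZ'[OF that], of "J i"]
    by auto
  have Qm: "Q_average M I x J N Z \<in> borel_measurable D"
    unfolding Q_average_def[abs_def] using Qop(1) by (intro borel_measurable_times borel_measurable_sum) auto
  have avgm: "avg \<in> borel_measurable D"
    unfolding avg_def[abs_def]
    by (intro R.bm_measurable R.bm_mult R.bm_const R.bm_sum R.fluct_bm Z'_bm)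
  have "AE y in D. \<forall>i\<in>{1..N}. Q_op M I x (J i) (Z i) y = R.fluct (J i) (Z' i) y"
    using Qop(2) by (intro AE_finite_allI) auto
  then have avg: "AE y in D. Q_average M I x J N Z y = avg y"
    by eventually_elim (simp add: Q_average_def avg_def)
  have "(\<integral>\<omega>. (Q_average M I x J N Z (config I x \<omega>)) ^ p \<partial>M) = (\<integral>y. (Q_average M I x J N Z y) ^ p \<partial>D)"
    unfolding D_def using Qm by (intro integral_distr[symmetric] conf) (auto simp: measD)
  also have "\<dots> = (\<integral>y. avg y ^ p \<partial>D)"
    using avg Qm avgm by (intro integral_cong_AE) auto
  also have "\<dots> \<le> Y ^ p * (C ^ (2 * p) * real p ^ (4 * p) * (X\<^sup>2 + 1 / real N) ^ p
        + real p ^ p * real p * \<delta> * (4 * C * real p * R) ^ (2 * p))"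
    unfolding avg_def
    by (rule R.fluct_average_moment_le[OF p N C R X Y _ Z'_bm Z'B split']) (simp add: \<delta>_def)
  finally show ?thesis unfolding \<delta> .
qed

section \<open>Choice of the constants\<close>

text \<open>
  With \<open>L = ln N\<close> the claim is \<open>2 C L - c L\<^sup>3\<^sup>/\<^sup>2 \<le> - L\<close>, multiplied by \<open>p\<close>; this is why the threshold for \<open>N\<close>
  can be chosen independently of \<open>p\<close>.
\<close>

lemma exp_log_power_le:
  fixes c C :: real and N p :: nat
  assumes c: "0 < c" and C: "0 \<le> C" and N: "exp (((2 * C + 1) / c)\<^sup>2) \<le> real N"
  shows "exp (- c * ln (real N) powr (3/2) * real p) * (real N powr C) ^ (2 * p) \<le> (1 / real N) ^ p"
proof -
  define L where "L = ln (real N)"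
  have N0: "0 < real N" using N exp_gt_zero order_less_le_trans by blast
  have L: "((2 * C + 1) / c)\<^sup>2 \<le> L"
    unfolding L_def using N N0 by (simp add: ln_ge_iff)
  have "(2 * C + 1) / c \<le> sqrt L"
    by (rule real_le_rsqrt[OF L])
  then have s: "2 * C + 1 \<le> c * sqrt L" using c by (simp add: field_simps)
  have "0 < ((2 * C + 1) / c)\<^sup>2" using c C by (intro zero_less_power) auto
  then have L0: "0 < L" using L by linarith
  have pw: "L powr (3/2) = L * sqrt L"
    using powr_add[of L 1 "1/2"] L0 by (simp add: powr_half_sqrt)
  have RN: "real N powr C = exp (C * L)" using N0 by (simp add: powr_def L_def)
  have iN: "1 / real N = exp (- L)" using N0 by (simp add: L_def exp_minus field_simps)
  have "exp (- c * L powr (3/2) * real p) * (real N powr C) ^ (2 * p)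
      = exp (real p * (2 * C * L - c * (L * sqrt L)))"
    unfolding RN pw by (simp add: exp_of_nat_mult[symmetric] exp_add[symmetric] algebra_simps)
  also have "\<dots> \<le> exp (real p * (- L))"
    unfolding exp_le_cancel_iff
    using mult_right_mono[OF s, of L] L0 by (intro mult_left_mono) (auto simp: algebra_simps)
  also have "\<dots> = (1 / real N) ^ p" unfolding iN by (rule exp_of_nat_mult)
  finally show ?thesis unfolding L_def .
qed

text \<open>
  Here \<open>e\<close> stands for \<open>(X\<^sup>2 + 1/N)\<^sup>p\<close>.  Since \<open>p \<ge> 1\<close>, the surplus factors \<open>p\<close> and \<open>2\<close> are at most
  \<open>p\<^sup>p\<close> and \<open>2\<^sup>p\<close>.
\<close>

lemma main_plus_error_le:
  fixes C :: real and p :: nat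
  assumes p: "0 < p" and C: "1 \<le> C" and e: "0 \<le> e" and \<delta>: "\<delta> * R ^ (2 * p) \<le> e"
  shows "C ^ (2 * p) * real p ^ (4 * p) * e + real p ^ p * real p * \<delta> * (4 * C * real p * R) ^ (2 * p)
    \<le> (32 * C\<^sup>2 * real p) ^ (4 * p) * e"
proof -
  have p1: "1 \<le> real p" using p by simp
  have "real p ^ p * real p * \<delta> * (4 * C * real p * R) ^ (2 * p)
      = (4 * C) ^ (2 * p) * (real p ^ (p + 1) * real p ^ (2 * p)) * (\<delta> * R ^ (2 * p))"
    by (simp add: power_mult_distrib algebra_simps)
  also have "\<dots> \<le> (4 * C) ^ (2 * p) * (real p ^ (p + 1) * real p ^ (2 * p)) * e"
    using C by (intro mult_left_mono \<delta>) auto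
  also have "\<dots> \<le> (4 * C) ^ (2 * p) * real p ^ (4 * p) * e"
    unfolding power_add[symmetric] using C p e p1
    by (intro mult_right_mono mult_left_mono power_increasing) auto
  finally have "C ^ (2 * p) * real p ^ (4 * p) * e + real p ^ p * real p * \<delta> * (4 * C * real p * R) ^ (2 * p)
      \<le> (C ^ (2 * p) + (4 * C) ^ (2 * p)) * real p ^ (4 * p) * e"
    by (simp add: algebra_simps)
  also have "\<dots> \<le> (32 * C\<^sup>2) ^ (4 * p) * real p ^ (4 * p) * e"
  proof (intro mult_right_mono e)
    have "C ^ (2 * p) + (4 * C) ^ (2 * p) \<le> 2 * (4 * C) ^ (2 * p)"
      using C by (simp add: power_mono)
    also have "\<dots> = 2 * (16 * C\<^sup>2) ^ p"
      unfolding power_mult by (simp add: power_mult_distrib)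
    also have "\<dots> \<le> 2 ^ p * (16 * C\<^sup>2) ^ p"
      using power_increasing[of 1 p "2::real"] p by (intro mult_right_mono) auto
    also have "\<dots> = (2 * (16 * C\<^sup>2)) ^ p"
      by (rule power_mult_distrib[symmetric])
    also have "\<dots> = (32 * C\<^sup>2) ^ p" by simp
    also have "\<dots> \<le> (32 * C\<^sup>2) ^ (4 * p)"
      using one_le_power[OF C, of 2] by (intro power_increasing) auto
    finally show "C ^ (2 * p) + (4 * C) ^ (2 * p) \<le> (32 * C\<^sup>2) ^ (4 * p)" .
  qed simp
  finally show ?thesis by (simp add: power_mult_distrib)
qed

theorem lemma7p3:
  fixes C0 c0 :: real
  assumes "C0 > 0" and "c0 > 0"
  shows "\<exists>C::real. C > 0 \<and> (\<exists>N0::nat. \<forall>N\<ge>N0.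
    \<forall>(M :: 'a measure) (I :: 'i set) (S :: 'i \<Rightarrow> 'b measure) (x :: 'i \<Rightarrow> 'a \<Rightarrow> 'b)
      (J :: nat \<Rightarrow> 'i set) (Z :: nat \<Rightarrow> ('i \<Rightarrow> 'b) \<Rightarrow> real) (\<Xi> :: ('i \<Rightarrow> 'b) set)
      (p :: nat) (X :: real) (Y :: real).
      prob_space M \<longrightarrow>
      finite I \<longrightarrow>
      (\<forall>i\<in>{1..N}. J i \<subseteq> I) \<longrightarrow>
      prob_space.indep_vars M S x I \<longrightarrow>
      (\<forall>i\<in>{1..N}. Z i \<in> borel_measurable (PiM I S)) \<longrightarrow>
      \<Xi> \<in> sets (PiM I S) \<longrightarrow>
      even p \<longrightarrow>
      0 < X \<longrightarrow> X < 1 \<longrightarrow> 0 < Y \<longrightarrow>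
      (\<forall>A i. A \<subseteq> {1..N} \<longrightarrow> i \<in> A \<longrightarrow> card A \<le> p \<longrightarrow>
        (\<exists>V\<in>borel_measurable (PiM I S). \<exists>W\<in>borel_measurable (PiM I S).
          (AE \<omega> in M.
            indicator \<Xi> (config I x \<omega>) * Q_prod M I x J A (Z i) (config I x \<omega>)
              = V (config I x \<omega>)
                + indicator \<Xi> (config I x \<omega>)
                  * Q_prod M I x J A (\<lambda>y. indicator (- \<Xi>) y * W y) (config I x \<omega>)) \<and>
          (AE \<omega> in M. \<bar>V (config I x \<omega>)\<bar> \<le> Y * (C0 * X * real (card A)) ^ card A) \<and>
          (AE \<omega> in M. \<bar>W (config I x \<omega>)\<bar> \<le> Y * real N powr (C0 * real (card A))))) \<longrightarrow>
      (\<forall>i\<in>{1..N}. AE \<omega> in M. \<bar>Z i (config I x \<omega>)\<bar> \<le> Y * real N powr C0) \<longrightarrow>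
      measure M {\<omega> \<in> space M. config I x \<omega> \<notin> \<Xi>} \<le> exp (- c0 * (ln (real N)) powr (3/2) * real p) \<longrightarrow>
      (LINT \<omega>|M. (Q_average M I x J N Z (config I x \<omega>)) ^ p)
        \<le> (C * real p) ^ (4 * p) * (X\<^sup>2 + 1 / real N) ^ p * Y ^ p)"
proof -
  \<comment> \<open>The assumptions only become weaker when \<open>C0\<close> is replaced by a larger constant.\<close>
  define C where "C = max 1 C0"
  define N0 where "N0 = nat \<lceil>exp (((2 * C + 1) / c0)\<^sup>2)\<rceil>"
  have C1: "1 \<le> C" and C0C: "C0 \<le> C" by (auto simp: C_def)
  show ?thesis
  proof (intro exI[of _ "32 * C\<^sup>2"] conjI exI[of _ N0] allI impI)
    show "0 < 32 * C\<^sup>2" using C1 by simp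
  next
    fix N :: nat and M :: "'a measure" and I :: "'i set" and S :: "'i \<Rightarrow> 'b measure"
      and x :: "'i \<Rightarrow> 'a \<Rightarrow> 'b" and J :: "nat \<Rightarrow> 'i set" and Z :: "nat \<Rightarrow> ('i \<Rightarrow> 'b) \<Rightarrow> real"
      and \<Xi> :: "('i \<Rightarrow> 'b) set" and p :: nat and X Y :: real
    assume N: "N0 \<le> N" and M: "prob_space M" and I: "finite I" and ind: "prob_space.indep_vars M S x I"
      and Z: "\<forall>i\<in>{1..N}. Z i \<in> borel_measurable (PiM I S)" and \<Xi>: "\<Xi> \<in> sets (PiM I S)"
      and X: "0 < X" "X < 1" and Y: "0 < Y"
      and split: "\<forall>A i. A \<subseteq> {1..N} \<longrightarrow> i \<in> A \<longrightarrow> card A \<le> p \<longrightarrow>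
        (\<exists>V\<in>borel_measurable (PiM I S). \<exists>W\<in>borel_measurable (PiM I S).
          (AE \<omega> in M.
            indicator \<Xi> (config I x \<omega>) * Q_prod M I x J A (Z i) (config I x \<omega>)
              = V (config I x \<omega>)
                + indicator \<Xi> (config I x \<omega>)
                  * Q_prod M I x J A (\<lambda>y. indicator (- \<Xi>) y * W y) (config I x \<omega>)) \<and>
          (AE \<omega> in M. \<bar>V (config I x \<omega>)\<bar> \<le> Y * (C0 * X * real (card A)) ^ card A) \<and>
          (AE \<omega> in M. \<bar>W (config I x \<omega>)\<bar> \<le> Y * real N powr (C0 * real (card A))))"
      and ZB: "\<forall>i\<in>{1..N}. AE \<omega> in M. \<bar>Z i (config I x \<omega>)\<bar> \<le> Y * real N powr C0"
      and prob: "measure M {\<omega> \<in> space M. config I x \<omega> \<notin> \<Xi>} \<le> exp (- c0 * (ln (real N)) powr (3/2) * real p)"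
    interpret prob_space M by (rule M)
    have Nexp: "exp (((2 * C + 1) / c0)\<^sup>2) \<le> real N"
      using N unfolding N0_def by linarith
    then have N1: "1 \<le> real N"
      using one_le_exp_iff[of "((2 * C + 1) / c0)\<^sup>2"] by (meson order_trans zero_le_power2)
    define R where "R = real N powr C"
    have R: "1 \<le> R" unfolding R_def using N1 C1 by (intro ge_one_powr_ge_zero) auto
    show "(LINT \<omega>|M. (Q_average M I x J N Z (config I x \<omega>)) ^ p)
        \<le> (32 * C\<^sup>2 * real p) ^ (4 * p) * (X\<^sup>2 + 1 / real N) ^ p * Y ^ p"
    proof (cases "p = 0")
      case True
      then show ?thesis by (simp add: prob_space)
    next
      case False
      have "(\<integral>\<omega>. (Q_average M I x J N Z (config I x \<omega>)) ^ p \<partial>M)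
        \<le> Y ^ p * (C ^ (2 * p) * real p ^ (4 * p) * (X\<^sup>2 + 1 / real N) ^ p
            + real p ^ p * real p * prob {\<omega> \<in> space M. config I x \<omega> \<notin> \<Xi>} * (4 * C * real p * R) ^ (2 * p))"
      proof (rule Q_average_moment_le[OF _ _ C1 R X Y I ind _ \<Xi>])
        fix i assume i: "i \<in> {1..N}"
        show "Z i \<in> borel_measurable (PiM I S)" using Z i by blast
        have "Y * real N powr C0 \<le> Y * R"
          unfolding R_def using Y N1 C0C by (intro mult_left_mono powr_mono) auto
        then show "AE \<omega> in M. \<bar>Z i (config I x \<omega>)\<bar> \<le> Y * R"
          using ZB[rule_format, OF i] by (auto elim: eventually_mono)
      next
        fix A i assume A: "A \<subseteq> {1..N}" "i \<in> A" "card A \<le> p"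
        have "(C0 * X * real (card A)) ^ card A \<le> (C * X * real (card A)) ^ card A"
          using X C0C \<open>C0 > 0\<close> by (intro power_mono mult_right_mono) auto
        then have v: "Y * (C0 * X * real (card A)) ^ card A \<le> Y * (C * X * real (card A)) ^ card A"
          using Y by simp
        have "real N powr (C0 * real (card A)) \<le> real N powr (C * real (card A))"
          using N1 C0C by (intro powr_mono mult_right_mono) auto
        also have "\<dots> = R ^ card A"
          unfolding R_def using N1 by (simp add: powr_powr[symmetric] powr_realpow)
        finally have w: "Y * real N powr (C0 * real (card A)) \<le> Y * R ^ card A"
          using Y by simp
        from split[rule_format, OF A] obtain V W where
          VW: "V \<in> borel_measurable (PiM I S)" "W \<in> borel_measurable (PiM I S)"
          "AE \<omega> in M.
            indicator \<Xi> (config I x \<omega>) * Q_prod M I x J A (Z i) (config I x \<omega>)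
              = V (config I x \<omega>)
                + indicator \<Xi> (config I x \<omega>)
                  * Q_prod M I x J A (\<lambda>y. indicator (- \<Xi>) y * W y) (config I x \<omega>)"
          and V: "AE \<omega> in M. \<bar>V (config I x \<omega>)\<bar> \<le> Y * (C0 * X * real (card A)) ^ card A"
          and W: "AE \<omega> in M. \<bar>W (config I x \<omega>)\<bar> \<le> Y * real N powr (C0 * real (card A))"
          by blast
        have "AE \<omega> in M. \<bar>V (config I x \<omega>)\<bar> \<le> Y * (C * X * real (card A)) ^ card A"
          using V v by (auto elim: eventually_mono)
        moreover have "AE \<omega> in M. \<bar>W (config I x \<omega>)\<bar> \<le> Y * R ^ card A"
          using W w by (auto elim: eventually_mono)
        ultimately show "\<exists>V\<in>borel_measurable (PiM I S). \<exists>W\<in>borel_measurable (PiM I S).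
          (AE \<omega> in M.
            indicator \<Xi> (config I x \<omega>) * Q_prod M I x J A (Z i) (config I x \<omega>)
              = V (config I x \<omega>)
                + indicator \<Xi> (config I x \<omega>)
                  * Q_prod M I x J A (\<lambda>y. indicator (- \<Xi>) y * W y) (config I x \<omega>)) \<and>
          (AE \<omega> in M. \<bar>V (config I x \<omega>)\<bar> \<le> Y * (C * X * real (card A)) ^ card A) \<and>
          (AE \<omega> in M. \<bar>W (config I x \<omega>)\<bar> \<le> Y * R ^ card A)"
          using VW by blast
      qed (use False N1 in auto)
      also have "\<dots> \<le> Y ^ p * ((32 * C\<^sup>2 * real p) ^ (4 * p) * (X\<^sup>2 + 1 / real N) ^ p)"
      proof (intro mult_left_mono main_plus_error_le C1)
        have "prob {\<omega> \<in> space M. config I x \<omega> \<notin> \<Xi>} * R ^ (2 * p)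
            \<le> exp (- c0 * (ln (real N)) powr (3/2) * real p) * R ^ (2 * p)"
          using R by (intro mult_right_mono prob) auto
        also have "\<dots> \<le> (1 / real N) ^ p"
          unfolding R_def using C1 by (intro exp_log_power_le \<open>c0 > 0\<close> Nexp) auto
        also have "\<dots> \<le> (X\<^sup>2 + 1 / real N) ^ p"
          by (intro power_mono) auto
        finally show "prob {\<omega> \<in> space M. config I x \<omega> \<notin> \<Xi>} * R ^ (2 * p) \<le> (X\<^sup>2 + 1 / real N) ^ p" .
      qed (use False Y in auto)
      finally show ?thesis by (simp add: mult.commute)
    qed
  qed
qed

end
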